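(* Let $\mathfrak{A}$ be a complete atomic weakly associative relation algebra and let $\mathfrak{B}=\langle B,T_\kappa,E_{\kappa\lambda}\rangle_{\kappa,\lambda<3}$ be the suitable structure of $\mathfrak{A}$. Then there is a set relation algebra $\mathfrak{A}'$ that is a subalgebra of $\mathfrak{Re}(U(\mathfrak{B}))$ such that $\mathfrak{A}\cong\mathfrak{Rl}_{S(\mathfrak{B})}(\mathfrak{A}')$, where $$S(\mathfrak{B})=\{\langle u,v\rangle: u,v\in U(\mathfrak{B}),\ \exists w\ \langle u,v,w\rangle\in V(\mathfrak{B})\}.$$
   Context: Weakly associative relation algebras (WA): an algebra $\mathfrak{A}=\langle A,+,\overline{\phantom{x}},;,\breve{\phantom{x}},1'\rangle$ (binary $+,;$; unary complement $\overline{x}$ and converse $\breve{x}$; constant $1'$), with abbreviations $x\cdot y=\overline{\overline{x}+\overline{y}}$, $0'=\overline{1'}$, $1=1'+0'$, $0=\overline{1}$, is in WA if for all $x,y,z$: $x+y=y+x$; $x+(y+z)=(x+y)+z$; $\overline{\overline{x}+\overline{y}}+\overline{\overline{x}+y}=x$; $((x\cdot 1');1);1=(x\cdot1');1$; $(x+y);z=x;z+y;z$; $x;1'=x$; $\breve{\breve{x}}=x$; $\breve{(x+y)}=\breve{x}+\breve{y}$; $\breve{(x;y)}=\breve{y};\breve{x}$; $\breve{x};\overline{x;y}+\overline{y}=\overline{y}$. $\le$ is the Boolean order; $\mathfrak{A}$ is complete/atomic if its Boolean reduct is; $\mathrm{At}(\mathfrak{A})$ is its set of atoms. Suitable structure of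 an atomic $\mathfrak{A}\in$ WA: $B=\{s\in{}^3\mathrm{At}(\mathfrak{A}): s_2;s_0\ge s_1\}$ (triples $s=\langle s_0,s_1,s_2\rangle$); for $\kappa<3$, $T_\kappa=\{\langle s,t\rangle\in B\times B: s_\kappa=t_\kappa\}$; $E_{\kappa\kappa}=B$; for distinct $\kappa,\lambda<3$ with $\mu$ the third element of $\{0,1,2\}$, $E_{\kappa\lambda}=\{s\in B:s_\mu\le 1'\}$. Trails: a $\mathfrak{B}$-trail is a sequence $p=\langle t_0,\kappa_0,\dots,t_n,\kappa_n\rangle$ with $n\in\omega$, $t_i\in B$, $\kappa_i<3$, and $t_i\ne t_{i+1}$, $\langle t_i,t_{i+1}\rangle\in T_{\kappa_i}$ for all $i<n$; $p$ ends at $t_n$. $\mathrm{Tr}(\mathfrak{B})$ is the set of trails. For $\lambda<3$, $p\lambda=\langle t_0,\kappa_0,\dots,t_{n-1},\kappa_{n-1},t_n,\lambda\rangle$. Let $\approx$ be the smallest equivalence relation on $\mathrm{Tr}(\mathfrak{B})$ such that (whenever the displayed sequences are trails): (a) $\langle t_0,\kappa_0,\dots,t_i,\lambda,s,\lambda,t_i,\kappa_i,\dots,t_n,\kappa_n\rangle\approx\langle t_0,\kappa_0,\dots,t_i,\kappa_i,\dots,t_n,\kappa_n\rangle$ ($0\le i\le n$); (b) $\langle t_0,\kappa_0,\dots,t_n,\lambda,s,\nu\rangle\approx\langle t_0,\kappa_0,\dots,t_n,\nu\rangle$ whenever $\lambda\neq\nu$; (c) $\langle t_0,\kappa_0,\dots,t_n,\lambda\rangle\approx\langle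 t_0,\kappa_0,\dots,t_n,\kappa_n\rangle$ whenever $t_n\in E_{\lambda\kappa_n}$. $p^{\mathfrak{B}}$ is the $\approx$-class of $p$; $U(\mathfrak{B})=\{p^{\mathfrak{B}}:p\in\mathrm{Tr}(\mathfrak{B})\}$; for $t\in B$, $R_t=\{\langle(p0)^{\mathfrak{B}},(p1)^{\mathfrak{B}},(p2)^{\mathfrak{B}}\rangle: p\in\mathrm{Tr}(\mathfrak{B})\text{ ends at }t\}$; $V(\mathfrak{B})=\bigcup_{t\in B}R_t$. $\mathfrak{Re}(U)=\langle\mathcal{P}(U\times U),\cup,U\times U\setminus\cdot,|,{}^{-1},Id_U\rangle$ is the algebra of all binary relations on $U$ (union, complement, relational composition, inverse, identity). A set relation algebra is a subalgebra of some $\mathfrak{Re}(U)$. For a subalgebra $\mathfrak{A}'$ of $\mathfrak{Re}(U)$ and $E\subseteq U\times U$, the relativization $\mathfrak{Rl}_E(\mathfrak{A}')$ has universe $\{R\cap E:R\in A'\}$ and operations $R+S=(R\cup S)\cap E$, $\overline{R}=(U\times U\setminus R)\cap E$, $R;S=(R|S)\cap E$, $\breve{R}=R^{-1}\cap E$, $1'=Id_U\cap E$. *)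

theory Defs
  imports Main
begin

record 'a ra_alg =
  car   :: "'a set"
  plus  :: "'a \<Rightarrow> 'a \<Rightarrow> 'a"
  cmpl  :: "'a \<Rightarrow> 'a"
  cmp   :: "'a \<Rightarrow> 'a \<Rightarrow> 'a"
  cnv   :: "'a \<Rightarrow> 'a"
  ident :: "'a"

definition meet :: "'a ra_alg \<Rightarrow> 'a \<Rightarrow> 'a \<Rightarrow> 'a" where
  "meet A x y = cmpl A (plus A (cmpl A x) (cmpl A y))"

definition diver :: "'a ra_alg \<Rightarrow> 'a" where
  "diver A = cmpl A (ident A)"

definition top :: "'a ra_alg \<Rightarrow> 'a" where
  "top A = plus A (ident A) (diver A)"

definition bot :: "'a ra_alg \<Rightarrow> 'a" where
  "bot A = cmpl A (top A)"

definition WA :: "'a ra_alg \<Rightarrow> bool" where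
  "WA A \<longleftrightarrow>
     ident A \<in> car A \<and>
     (\<forall>x\<in>car A. \<forall>y\<in>car A. plus A x y \<in> car A \<and> cmp A x y \<in> car A) \<and>
     (\<forall>x\<in>car A. cmpl A x \<in> car A \<and> cnv A x \<in> car A) \<and>
     (\<forall>x\<in>car A. \<forall>y\<in>car A. \<forall>z\<in>car A.
        plus A x y = plus A y x \<and>
        plus A x (plus A y z) = plus A (plus A x y) z \<and>
        plus A (cmpl A (plus A (cmpl A x) (cmpl A y))) (cmpl A (plus A (cmpl A x) y)) = x \<and>
        cmp A (cmp A (meet A x (ident A)) (top A)) (top A) = cmp A (meet A x (ident A)) (top A) \<and>
        cmp A (plus A x y) z = plus A (cmp A x z) (cmp A y z) \<and>
        cmp A x (ident A) = x \<and>
        cnv A (cnv A x) = x \<and>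
        cnv A (plus A x y) = plus A (cnv A x) (cnv A y) \<and>
        cnv A (cmp A x y) = cmp A (cnv A y) (cnv A x) \<and>
        plus A (cmp A (cnv A x) (cmpl A (cmp A x y))) (cmpl A y) = cmpl A y)"

definition leq :: "'a ra_alg \<Rightarrow> 'a \<Rightarrow> 'a \<Rightarrow> bool" where
  "leq A x y \<longleftrightarrow> plus A x y = y"

definition atoms :: "'a ra_alg \<Rightarrow> 'a set" where
  "atoms A = {a \<in> car A. a \<noteq> bot A \<and>
                 (\<forall>b\<in>car A. leq A b a \<longrightarrow> b = bot A \<or> b = a)}"

definition ra_complete :: "'a ra_alg \<Rightarrow> bool" where
  "ra_complete A \<longleftrightarrow>
     (\<forall>X \<subseteq> car A. \<exists>s\<in>car A. (\<forall>x\<in>X. leq A x s) \<and>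
                              (\<forall>u\<in>car A. (\<forall>x\<in>X. leq A x u) \<longrightarrow> leq A s u))"

definition ra_atomic :: "'a ra_alg \<Rightarrow> bool" where
  "ra_atomic A \<longleftrightarrow>
     (\<forall>x\<in>car A. x \<noteq> bot A \<longrightarrow> (\<exists>a\<in>atoms A. leq A a x))"

type_synonym 'a triple = "'a \<times> 'a \<times> 'a"

definition cmpnt :: "'a triple \<Rightarrow> nat \<Rightarrow> 'a" where
  "cmpnt s k = (if k = 0 then fst s else if k = 1 then fst (snd s) else snd (snd s))"

definition SB :: "'a ra_alg \<Rightarrow> 'a triple set" where
  "SB A = {s. cmpnt s 0 \<in> atoms A \<and> cmpnt s 1 \<in> atoms A \<and> cmpnt s 2 \<in> atoms A \<and>
              leq A (cmpnt s 1) (cmp A (cmpnt s 2) (cmpnt s 0))}"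

definition ST :: "'a ra_alg \<Rightarrow> nat \<Rightarrow> ('a triple \<times> 'a triple) set" where
  "ST A k = {(s, t). s \<in> SB A \<and> t \<in> SB A \<and> cmpnt s k = cmpnt t k}"

definition SE :: "'a ra_alg \<Rightarrow> nat \<Rightarrow> nat \<Rightarrow> 'a triple set" where
  "SE A k l = (if k = l then SB A
               else {s \<in> SB A. leq A (cmpnt s (3 - k - l)) (ident A)})"

text \<open>A trail \<open>\<langle>t0,k0,...,tn,kn\<rangle>\<close> is a nonempty list of pairs \<open>(t_i, k_i)\<close>.\<close>

type_synonym 'a trail = "('a triple \<times> nat) list"

definition trails :: "'a ra_alg \<Rightarrow> 'a trail set" where
  "trails A = {p. p \<noteq> [] \<and> (\<forall>i < length p. fst (p ! i) \<in> SB A \<and> snd (p ! i) < 3) \<and>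
     (\<forall>i. Suc i < length p \<longrightarrow> fst (p ! i) \<noteq> fst (p ! Suc i) \<and>
            (fst (p ! i), fst (p ! Suc i)) \<in> ST A (snd (p ! i)))}"

definition ends_at :: "'a trail \<Rightarrow> 'a triple \<Rightarrow> bool" where
  "ends_at p t \<longleftrightarrow> p \<noteq> [] \<and> fst (last p) = t"

definition set_last :: "'a trail \<Rightarrow> nat \<Rightarrow> 'a trail" where
  "set_last p l = butlast p @ [(fst (last p), l)]"

definition trail_gen :: "'a ra_alg \<Rightarrow> ('a trail \<times> 'a trail) set" where
  "trail_gen A = {(p, q). p \<in> trails A \<and> q \<in> trails A \<and>
     ((\<exists>pre post t k l s. p = pre @ [(t, l), (s, l), (t, k)] @ post \<and> q = pre @ [(t, k)] @ post) \<or>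
      (\<exists>pre t l s n. l \<noteq> n \<and> p = pre @ [(t, l), (s, n)] \<and> q = pre @ [(t, n)]) \<or>
      (\<exists>pre t l k. t \<in> SE A l k \<and> p = pre @ [(t, l)] \<and> q = pre @ [(t, k)]))}"

definition trail_eq :: "'a ra_alg \<Rightarrow> ('a trail \<times> 'a trail) set" where
  "trail_eq A = Id_on (trails A) \<union> (trail_gen A \<union> (trail_gen A)\<inverse>)\<^sup>+"

definition trail_cls :: "'a ra_alg \<Rightarrow> 'a trail \<Rightarrow> 'a trail set" where
  "trail_cls A p = trail_eq A `` {p}"

definition UB :: "'a ra_alg \<Rightarrow> 'a trail set set" where
  "UB A = trail_cls A ` trails A"

definition RB :: "'a ra_alg \<Rightarrow> 'a triple \<Rightarrow> ('a trail set) triple set" where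
  "RB A t = {(trail_cls A (set_last p 0), trail_cls A (set_last p 1), trail_cls A (set_last p 2)) | p.
              p \<in> trails A \<and> ends_at p t}"

definition VB :: "'a ra_alg \<Rightarrow> ('a trail set) triple set" where
  "VB A = (\<Union>t\<in>SB A. RB A t)"

definition SS :: "'a ra_alg \<Rightarrow> ('a trail set \<times> 'a trail set) set" where
  "SS A = {(u, v). u \<in> UB A \<and> v \<in> UB A \<and> (\<exists>w. (u, v, w) \<in> VB A)}"

definition set_ra_sub :: "'u set \<Rightarrow> ('u \<times> 'u) set set \<Rightarrow> bool" where
  "set_ra_sub U R \<longleftrightarrow>
     R \<subseteq> Pow (U \<times> U) \<and> Id_on U \<in> R \<and>
     (\<forall>X\<in>R. \<forall>Y\<in>R. X \<union> Y \<in> R \<and> X O Y \<in> R) \<and>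
     (\<forall>X\<in>R. (U \<times> U) - X \<in> R \<and> X\<inverse> \<in> R)"

definition relativize :: "'u set \<Rightarrow> ('u \<times> 'u) set set \<Rightarrow> ('u \<times> 'u) set \<Rightarrow> ('u \<times> 'u) set ra_alg" where
  "relativize U R E =
     \<lparr> car = (\<lambda>X. X \<inter> E) ` R,
       plus = (\<lambda>X Y. (X \<union> Y) \<inter> E),
       cmpl = (\<lambda>X. ((U \<times> U) - X) \<inter> E),
       cmp = (\<lambda>X Y. (X O Y) \<inter> E),
       cnv = (\<lambda>X. X\<inverse> \<inter> E),
       ident = Id_on U \<inter> E \<rparr>"

definition ra_iso :: "'a ra_alg \<Rightarrow> 'b ra_alg \<Rightarrow> bool" where
  "ra_iso A B \<longleftrightarrow> (\<exists>h. bij_betw h (car A) (car B) \<and>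
     (\<forall>x\<in>car A. \<forall>y\<in>car A. h (plus A x y) = plus B (h x) (h y) \<and>
                           h (cmp A x y) = cmp B (h x) (h y)) \<and>
     (\<forall>x\<in>car A. h (cmpl A x) = cmpl B (h x) \<and> h (cnv A x) = cnv B (h x)) \<and>
     h (ident A) = ident B)"

end

theory Submission
  imports Defs
begin

text \<open>
  A trail is a walk through triangles glued along common faces, and an element of \<open>UB A\<close> is a corner
  of a triangle reached by such a walk. An atom \<open>a\<close> is represented by the pairs of corners \<open>0\<close>, \<open>1\<close>
  of triangles whose edge \<open>01\<close> carries \<open>a\<close>, and \<open>x\<close> by the union over the atoms below \<open>x\<close>.

  The main difficulty is that corners are classes of trails: one must see that a pair of corners
  carries at most one atom, and that three pairwise related corners form a consistent triangle.
  Both are clear in a free model, in which points are added one at a time to an existing edge, since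
  a new point is then related only to itself and to the ends of that edge. In the free model every
  realised triangle can be extended across each of its faces to any fitting triangle. Choosing
  extensions along trails freed of backtracking maps \<open>UB A\<close> to the model, preserving edges, and
  pulls both properties back.

  For the subalgebra, take all relations on \<open>UB A\<close> invariant under the permutations that exchange
  the components of two triangles with a common face by prefixing one step to the trails. The pairs
  carrying a given atom are invariant and any two of them are connected by such permutations, so the
  traces of invariant relations on \<open>SS A\<close> are exactly the unions of represented atoms; by
  completeness these are the represented elements.
\<close>

section \<open>Boolean algebra from the Huntington axioms, and consistent triangles of atoms\<close>

locale wa =
  fixes A :: "'a ra_alg"
  assumes WA: "WA A"
begin

abbreviation pl (infixl "\<oplus>" 65) where "x \<oplus> y \<equiv> plus A x y"
abbreviation mul (infixl "\<odot>" 70) where "x \<odot> y \<equiv> cmp A x y"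
abbreviation ng ("\<sim> _" [81] 81) where "\<sim> x \<equiv> cmpl A x"
abbreviation cv ("_\<^sup>c" [1000] 1000) where "x\<^sup>c \<equiv> cnv A x"
abbreviation le (infix "\<sqsubseteq>" 50) where "x \<sqsubseteq> y \<equiv> leq A x y"
abbreviation K where "K \<equiv> car A"
abbreviation one where "one \<equiv> ident A"
abbreviation At where "At \<equiv> atoms A"

lemma closed [simp, intro]:
  "one \<in> K" "x \<in> K \<Longrightarrow> y \<in> K \<Longrightarrow> x \<oplus> y \<in> K" "x \<in> K \<Longrightarrow> y \<in> K \<Longrightarrow> x \<odot> y \<in> K"
  "x \<in> K \<Longrightarrow> \<sim> x \<in> K" "x \<in> K \<Longrightarrow> x\<^sup>c \<in> K"
  using WA unfolding WA_def by blast+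

lemma top_closed [simp, intro]: "top A \<in> K"
  by (simp add: top_def diver_def)

lemma bot_closed [simp, intro]: "bot A \<in> K"
  by (simp add: bot_def)

lemma meet_closed [simp, intro]: "x \<in> K \<Longrightarrow> y \<in> K \<Longrightarrow> meet A x y \<in> K"
  by (simp add: meet_def)

lemma
  assumes "x \<in> K" "y \<in> K"
  shows plus_commute: "x \<oplus> y = y \<oplus> x"
    and huntington: "\<sim> (\<sim> x \<oplus> \<sim> y) \<oplus> \<sim> (\<sim> x \<oplus> y) = x"
    and cnv_plus: "(x \<oplus> y)\<^sup>c = x\<^sup>c \<oplus> y\<^sup>c"
    and cnv_cmp: "(x \<odot> y)\<^sup>c = y\<^sup>c \<odot> x\<^sup>c"
    and cmp_residual: "(x\<^sup>c \<odot> \<sim> (x \<odot> y)) \<oplus> \<sim> y = \<sim> y"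
  using WA assms unfolding WA_def by blast+

lemma
  assumes "x \<in> K" "y \<in> K" "z \<in> K"
  shows plus_assoc: "x \<oplus> (y \<oplus> z) = x \<oplus> y \<oplus> z"
    and cmp_plus_left: "(x \<oplus> y) \<odot> z = x \<odot> z \<oplus> y \<odot> z"
  using WA assms unfolding WA_def by blast+

lemma
  assumes "x \<in> K"
  shows weak_assoc: "meet A x one \<odot> top A \<odot> top A = meet A x one \<odot> top A"
    and cmp_one_right: "x \<odot> one = x"
    and cnv_cnv [simp]: "x\<^sup>c\<^sup>c = x"
  using WA assms closed(1) unfolding WA_def by blast+

lemma plus_left_commute:
  assumes "x \<in> K" "y \<in> K" "z \<in> K"
  shows "x \<oplus> (y \<oplus> z) = y \<oplus> (x \<oplus> z)"
  using assms by (metis plus_assoc plus_commute)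

lemmas plus_ac = plus_assoc [symmetric] plus_commute plus_left_commute

text \<open>By \<open>huntington\<close>, \<open>x\<close> and \<open>\<sim> x\<close> split along
  \<open>y\<close>, and \<open>y\<close> and \<open>\<sim> y\<close> along \<open>x\<close>, into
  the same four terms.\<close>

lemma plus_compl_eq:
  assumes "x \<in> K" "y \<in> K"
  shows "x \<oplus> \<sim> x = y \<oplus> \<sim> y"
proof -
  have "x \<oplus> \<sim> x = (\<sim> (\<sim> x \<oplus> \<sim> \<sim> y) \<oplus> \<sim> (\<sim> x \<oplus> \<sim> y)) \<oplus> (\<sim> (\<sim> \<sim> x \<oplus> \<sim> \<sim> y) \<oplus> \<sim> (\<sim> \<sim> x \<oplus> \<sim> y))"
    using assms by (simp add: huntington)
  also have "\<dots> = (\<sim> (\<sim> y \<oplus> \<sim> \<sim> x) \<oplus> \<sim> (\<sim> y \<oplus> \<sim> x)) \<oplus> (\<sim> (\<sim> \<sim> y \<oplus> \<sim> \<sim> x) \<oplus> \<sim> (\<sim> \<sim> y \<oplus> \<sim> x))"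
    using assms by (simp add: plus_ac)
  also have "\<dots> = y \<oplus> \<sim> y"
    using assms by (simp add: huntington)
  finally show ?thesis .
qed

lemma plus_compl: "x \<in> K \<Longrightarrow> x \<oplus> \<sim> x = top A"
  unfolding top_def diver_def by (rule plus_compl_eq) auto

lemma compl_compl [simp]:
  assumes "x \<in> K" shows "\<sim> \<sim> x = x"
proof -
  have "\<sim> \<sim> x = \<sim> (\<sim> \<sim> \<sim> x \<oplus> \<sim> \<sim> x) \<oplus> \<sim> (\<sim> \<sim> \<sim> x \<oplus> \<sim> x)"
    using assms huntington[of "\<sim> \<sim> x" "\<sim> x"] by simp
  also have "\<sim> \<sim> \<sim> x \<oplus> \<sim> \<sim> x = \<sim> x \<oplus> \<sim> \<sim> x"
    using assms by (metis closed(4) plus_compl_eq plus_commute)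
  also have "\<sim> (\<sim> x \<oplus> \<sim> \<sim> x) \<oplus> \<sim> (\<sim> \<sim> \<sim> x \<oplus> \<sim> x) = \<sim> (\<sim> x \<oplus> \<sim> \<sim> \<sim> x) \<oplus> \<sim> (\<sim> x \<oplus> \<sim> \<sim> x)"
    using assms by (simp add: plus_ac)
  also have "\<dots> = x"
    using assms huntington[of x "\<sim> \<sim> x"] by simp
  finally show ?thesis .
qed

lemma compl_top: "\<sim> top A = bot A" by (simp add: bot_def)
lemma compl_bot: "\<sim> bot A = top A" by (simp add: bot_def)

text \<open>The axioms do not include idempotence. It is obtained for the top first;
  \<open>plus_bot\<close> and then \<open>plus_idem\<close> build on this case.\<close>

lemma top_plus_top: "top A \<oplus> top A = top A"
proof -
  let ?i = "top A" and ?o = "bot A"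
  have i: "?i \<oplus> ?o = ?i" using plus_compl[of ?i] by (simp add: compl_top)
  have "?o = \<sim> (?i \<oplus> ?i) \<oplus> ?o"
    using huntington[of ?o ?o] i by (simp add: compl_bot compl_top)
  hence "?i = ?i \<oplus> \<sim> (?i \<oplus> ?i)"
    using i by (metis plus_assoc plus_commute closed(2,4) top_closed bot_closed)
  hence "?i \<oplus> ?i = (?i \<oplus> ?i) \<oplus> \<sim> (?i \<oplus> ?i)"
    by (metis plus_assoc closed(2,4) top_closed)
  thus ?thesis using plus_compl[of "?i \<oplus> ?i"] by simp
qed

lemma plus_bot [simp]:
  assumes "x \<in> K" shows "x \<oplus> bot A = x"
proof -
  have o: "bot A \<oplus> bot A = bot A"
    using huntington[of "bot A" "bot A"] top_plus_top plus_compl[of "top A"]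
    by (simp add: compl_bot compl_top)
  have "x = \<sim> (\<sim> x \<oplus> \<sim> x) \<oplus> bot A"
    using huntington[of x x] plus_compl[of x] plus_commute[of x "\<sim> x"] assms by (simp add: compl_top)
  thus ?thesis using o assms by (metis plus_assoc bot_closed closed(2,4))
qed

lemma bot_plus [simp]: "x \<in> K \<Longrightarrow> bot A \<oplus> x = x"
  using plus_commute[of x "bot A"] by simp

lemma plus_idem [simp]:
  assumes "x \<in> K" shows "x \<oplus> x = x"
proof -
  have "y = \<sim> (\<sim> y \<oplus> \<sim> y)" if "y \<in> K" for y
    using huntington[of y y] plus_compl[of y] plus_commute[of y "\<sim> y"] that by (simp add: compl_top)
  thus ?thesis using assms by (metis compl_compl closed(2,4))
qed

lemma plus_meet: "x \<in> K \<Longrightarrow> y \<in> K \<Longrightarrow> meet A x y \<oplus> meet A x (\<sim> y) = x"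
  unfolding meet_def using huntington[of x y] by simp

lemma meet_commute: "x \<in> K \<Longrightarrow> y \<in> K \<Longrightarrow> meet A x y = meet A y x"
  by (simp add: meet_def plus_commute)

section \<open>The Boolean order and its atoms\<close>

lemma le_refl [simp]: "x \<in> K \<Longrightarrow> x \<sqsubseteq> x"
  by (simp add: leq_def)

lemma le_antisym: "x \<in> K \<Longrightarrow> y \<in> K \<Longrightarrow> x \<sqsubseteq> y \<Longrightarrow> y \<sqsubseteq> x \<Longrightarrow> x = y"
  by (metis leq_def plus_commute)

lemma le_trans: "x \<in> K \<Longrightarrow> y \<in> K \<Longrightarrow> z \<in> K \<Longrightarrow> x \<sqsubseteq> y \<Longrightarrow> y \<sqsubseteq> z \<Longrightarrow> x \<sqsubseteq> z"
  by (metis leq_def plus_assoc)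

lemma le_plus1: "x \<in> K \<Longrightarrow> y \<in> K \<Longrightarrow> x \<sqsubseteq> x \<oplus> y"
  by (simp add: leq_def plus_assoc)

lemma le_plus2: "x \<in> K \<Longrightarrow> y \<in> K \<Longrightarrow> y \<sqsubseteq> x \<oplus> y"
  using le_plus1[of y x] by (simp add: plus_commute)

lemma plus_least: "x \<in> K \<Longrightarrow> y \<in> K \<Longrightarrow> z \<in> K \<Longrightarrow> x \<sqsubseteq> z \<Longrightarrow> y \<sqsubseteq> z \<Longrightarrow> x \<oplus> y \<sqsubseteq> z"
  by (metis leq_def plus_assoc)

lemma meet_le1: "x \<in> K \<Longrightarrow> y \<in> K \<Longrightarrow> meet A x y \<sqsubseteq> x"
  using le_plus1[of "meet A x y" "meet A x (\<sim> y)"] by (simp add: plus_meet)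

lemma meet_le2: "x \<in> K \<Longrightarrow> y \<in> K \<Longrightarrow> meet A x y \<sqsubseteq> y"
  using meet_le1[of y x] by (simp add: meet_commute)

lemma compl_antimono:
  assumes "x \<in> K" "y \<in> K" "x \<sqsubseteq> y" shows "\<sim> y \<sqsubseteq> \<sim> x"
  using meet_le1[of "\<sim> x" "\<sim> y"] assms unfolding meet_def by (simp add: leq_def)

lemma compl_le_iff: "x \<in> K \<Longrightarrow> y \<in> K \<Longrightarrow> x \<sqsubseteq> \<sim> y \<longleftrightarrow> y \<sqsubseteq> \<sim> x"
  by (metis compl_antimono compl_compl closed(4))

lemma meet_greatest:
  assumes "x \<in> K" "y \<in> K" "z \<in> K" "z \<sqsubseteq> x" "z \<sqsubseteq> y" shows "z \<sqsubseteq> meet A x y"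
proof -
  have "\<sim> x \<oplus> \<sim> y \<sqsubseteq> \<sim> z" using assms by (simp add: plus_least compl_antimono)
  thus ?thesis unfolding meet_def using assms compl_le_iff[of z "\<sim> x \<oplus> \<sim> y"] by simp
qed

lemma bot_le [simp]: "x \<in> K \<Longrightarrow> bot A \<sqsubseteq> x"
  by (simp add: leq_def)

lemma le_top [simp]: "x \<in> K \<Longrightarrow> x \<sqsubseteq> top A"
  using le_plus1[of x "\<sim> x"] by (simp add: plus_compl)

lemma meet_compl: "x \<in> K \<Longrightarrow> meet A x (\<sim> x) = bot A"
  by (simp add: meet_def plus_compl plus_commute[of "\<sim> x" x] compl_top)

lemma le_bot: "x \<in> K \<Longrightarrow> x \<sqsubseteq> bot A \<Longrightarrow> x = bot A"
  by (rule le_antisym) auto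

lemma atom_closed [simp, intro]: "a \<in> At \<Longrightarrow> a \<in> K"
  by (simp add: atoms_def)

lemma atom_not_bot: "a \<in> At \<Longrightarrow> a \<noteq> bot A"
  unfolding atoms_def by blast

lemma atom_minimal: "a \<in> At \<Longrightarrow> b \<in> K \<Longrightarrow> b \<noteq> bot A \<Longrightarrow> b \<sqsubseteq> a \<Longrightarrow> b = a"
  unfolding atoms_def by blast

lemma atom_le_atom: "a \<in> At \<Longrightarrow> b \<in> At \<Longrightarrow> b \<sqsubseteq> a \<Longrightarrow> b = a"
  using atom_minimal[of a b] atom_not_bot[of b] by simp

lemma atom_le_compl:
  assumes "a \<in> At" "x \<in> K" shows "a \<sqsubseteq> \<sim> x \<longleftrightarrow> \<not> a \<sqsubseteq> x"
proof
  assume "a \<sqsubseteq> \<sim> x"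
  thus "\<not> a \<sqsubseteq> x"
    using meet_greatest[of x "\<sim> x" a] assms atom_not_bot[of a] le_bot[of a] by (auto simp: meet_compl)
next
  assume n: "\<not> a \<sqsubseteq> x"
  have "meet A a x = bot A"
    using assms n atom_minimal[of a "meet A a x"] meet_le1[of a x] meet_le2[of a x] by force
  hence "meet A a (\<sim> x) = a"
    using plus_meet[of a x] assms by simp
  thus "a \<sqsubseteq> \<sim> x" using meet_le2[of a "\<sim> x"] assms by simp
qed

lemma atom_le_plus:
  assumes "a \<in> At" "x \<in> K" "y \<in> K" shows "a \<sqsubseteq> x \<oplus> y \<longleftrightarrow> a \<sqsubseteq> x \<or> a \<sqsubseteq> y"
proof
  assume l: "a \<sqsubseteq> x \<oplus> y"
  show "a \<sqsubseteq> x \<or> a \<sqsubseteq> y"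
  proof (rule ccontr)
    assume "\<not> ?thesis"
    hence "a \<sqsubseteq> meet A (\<sim> x) (\<sim> y)"
      using assms by (intro meet_greatest) (auto simp: atom_le_compl)
    thus False using l assms by (simp add: meet_def atom_le_compl)
  qed
qed (use assms le_trans[of a _ "x \<oplus> y"] le_plus1[of x y] le_plus2[of x y] in auto)

section \<open>Converse, composition and the Peircean law\<close>

lemma cnv_mono: "x \<in> K \<Longrightarrow> y \<in> K \<Longrightarrow> x \<sqsubseteq> y \<Longrightarrow> x\<^sup>c \<sqsubseteq> y\<^sup>c"
  by (metis leq_def cnv_plus)

lemma cnv_le_iff: "x \<in> K \<Longrightarrow> y \<in> K \<Longrightarrow> x\<^sup>c \<sqsubseteq> y \<longleftrightarrow> x \<sqsubseteq> y\<^sup>c"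
  by (metis cnv_mono cnv_cnv closed(5))

lemma cmp_mono_left: "x \<in> K \<Longrightarrow> y \<in> K \<Longrightarrow> z \<in> K \<Longrightarrow> x \<sqsubseteq> y \<Longrightarrow> x \<odot> z \<sqsubseteq> y \<odot> z"
  by (metis leq_def cmp_plus_left)

lemma cmp_mono_right:
  assumes "x \<in> K" "y \<in> K" "z \<in> K" "x \<sqsubseteq> y" shows "z \<odot> x \<sqsubseteq> z \<odot> y"
proof -
  have "x\<^sup>c \<odot> z\<^sup>c \<sqsubseteq> y\<^sup>c \<odot> z\<^sup>c" using assms by (simp add: cmp_mono_left cnv_mono)
  thus ?thesis using assms cnv_mono[of "x\<^sup>c \<odot> z\<^sup>c" "y\<^sup>c \<odot> z\<^sup>c"] by (simp add: cnv_cmp)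
qed

lemma cmp_mono:
  assumes "x \<in> K" "y \<in> K" "x' \<in> K" "y' \<in> K" "x \<sqsubseteq> x'" "y \<sqsubseteq> y'"
  shows "x \<odot> y \<sqsubseteq> x' \<odot> y'"
  using assms cmp_mono_left[of x x' y] cmp_mono_right[of y y' x'] le_trans by (meson closed(3))

lemma cnv_one: "one\<^sup>c = one"
  by (metis closed(1,5) cmp_one_right cnv_cmp cnv_cnv)

lemma cmp_one_left: "x \<in> K \<Longrightarrow> one \<odot> x = x"
  by (metis closed(1,5) cmp_one_right cnv_cmp cnv_cnv cnv_one)

text \<open>Since \<open>z\<close> lies below the complement of \<open>x \<odot> y\<close>,
  monotonicity reduces the claim to the axiom \<open>cmp_residual\<close>.\<close>

lemma peirce:
  assumes "x \<in> K" "y \<in> K" "z \<in> K" "x \<odot> y \<sqsubseteq> \<sim> z" shows "x\<^sup>c \<odot> z \<sqsubseteq> \<sim> y"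
proof -
  have "x\<^sup>c \<odot> z \<sqsubseteq> x\<^sup>c \<odot> \<sim> (x \<odot> y)"
    using assms compl_le_iff[of "x \<odot> y" z] by (simp add: cmp_mono_right)
  moreover have "x\<^sup>c \<odot> \<sim> (x \<odot> y) \<sqsubseteq> \<sim> y"
    using assms cmp_residual by (simp add: leq_def)
  ultimately show ?thesis using assms le_trans by (meson closed)
qed

lemma cnv_bot: "(bot A)\<^sup>c = bot A"
  by (metis bot_closed bot_le closed(5) cnv_le_iff le_bot)

lemma cnv_atom [simp, intro]:
  assumes "a \<in> At" shows "a\<^sup>c \<in> At"
  unfolding atoms_def
proof (clarsimp simp: assms, intro conjI ballI impI)
  show "a\<^sup>c \<noteq> bot A" using assms by (metis atom_closed atom_not_bot cnv_bot cnv_cnv)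
  fix b assume b: "b \<in> K" "b \<sqsubseteq> a\<^sup>c"
  hence "b\<^sup>c \<sqsubseteq> a" using assms by (simp add: cnv_le_iff)
  hence "b\<^sup>c = bot A \<or> b\<^sup>c = a" using assms b atom_minimal by auto
  thus "b = bot A \<or> b = a\<^sup>c" using b by (metis cnv_bot cnv_cnv)
qed

text \<open>\<open>C a b c\<close>: there is a consistent triangle whose edges \<open>01\<close>, \<open>12\<close>, \<open>02\<close> carry \<open>a\<close>, \<open>b\<close>, \<open>c\<close>.\<close>

definition C :: "'a \<Rightarrow> 'a \<Rightarrow> 'a \<Rightarrow> bool" where
  "C a b c \<longleftrightarrow> a \<in> At \<and> b \<in> At \<and> c \<in> At \<and> c \<sqsubseteq> a \<odot> b"

definition I :: "'a set" where
  "I = {e \<in> At. e \<sqsubseteq> one}"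

lemma C_atoms: assumes "C a b c" shows "a \<in> At" "b \<in> At" "c \<in> At"
  using assms by (auto simp: C_def)

lemma I_atom [simp, intro]: "e \<in> I \<Longrightarrow> e \<in> At"
  unfolding I_def by blast

lemma I_le_one: "e \<in> I \<Longrightarrow> e \<sqsubseteq> one"
  unfolding I_def by blast

lemma I_intro: "e \<in> At \<Longrightarrow> e \<sqsubseteq> one \<Longrightarrow> e \<in> I"
  unfolding I_def by blast

text \<open>For an atom, not lying below an element means lying below its complement, so this is the
  contrapositive of \<open>peirce\<close>.\<close>

lemma atom_peirce:
  assumes "x \<in> K" "b \<in> At" "c \<in> At" "c \<sqsubseteq> x \<odot> b" shows "b \<sqsubseteq> x\<^sup>c \<odot> c"
proof (rule ccontr)
  assume "\<not> ?thesis"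
  hence "x\<^sup>c \<odot> c \<sqsubseteq> \<sim> b" using assms by (subst compl_le_iff) (auto simp: atom_le_compl)
  hence "x \<odot> b \<sqsubseteq> \<sim> c" using peirce[of "x\<^sup>c" c b] assms by simp
  hence "c \<sqsubseteq> \<sim> c" using assms le_trans[of c "x \<odot> b" "\<sim> c"] by simp
  thus False using assms by (simp add: atom_le_compl)
qed

text \<open>The corners 0 and 1 of the triangle are exchanged; \<open>C_cnv\<close> exchanges 0 and
  2, and \<open>C_peirce'\<close> exchanges 1 and 2.\<close>

lemma C_peirce: "C a b c \<Longrightarrow> C (a\<^sup>c) c b"
  using atom_peirce[of a b c] by (simp add: C_def)

lemma C_cnv:
  assumes "C a b c" shows "C (b\<^sup>c) (a\<^sup>c) (c\<^sup>c)"
  using assms cnv_mono[of c "a \<odot> b"] by (simp add: C_def cnv_cmp)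

lemma C_peirce':
  assumes "C a b c" shows "C c (b\<^sup>c) a"
  using C_cnv[OF C_peirce[OF C_cnv[OF assms]]] C_atoms[OF assms] by simp

lemma cnv_I_closed:
  assumes "e \<in> I" shows "e\<^sup>c \<in> I"
proof (rule I_intro)
  show "e\<^sup>c \<in> At" using assms by blast
  show "e\<^sup>c \<sqsubseteq> one" using cnv_mono[of e one] I_le_one[OF assms] I_atom[OF assms] by (simp add: cnv_one)
qed

lemma C_I_left:
  assumes "e \<in> I" "C e a b" shows "a = b"
proof -
  have "b \<sqsubseteq> one \<odot> a"
    using assms I_atom[of e] cmp_mono_left[of e one a] le_trans[of b "e \<odot> a" "one \<odot> a"]
    unfolding C_def by (simp add: I_le_one)
  thus ?thesis using assms atom_le_atom[of a b] by (simp add: C_def cmp_one_left)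
qed

lemma C_I_right:
  assumes "e \<in> I" "C a e b" shows "a = b"
  using C_I_left[OF cnv_I_closed[OF assms(1)] C_cnv[OF assms(2)]] C_atoms[OF assms(2)]
  by (metis atom_closed cnv_cnv)

end

section \<open>Atomic algebras, with domain and range of atoms\<close>

locale atomic_wa = wa +
  assumes atomic: "ra_atomic A"
begin

lemma ex_atom_below: "x \<in> K \<Longrightarrow> x \<noteq> bot A \<Longrightarrow> \<exists>a\<in>At. a \<sqsubseteq> x"
  using atomic unfolding ra_atomic_def by blast

lemma le_if_atoms_le:
  assumes "x \<in> K" "y \<in> K" "\<And>a. a \<in> At \<Longrightarrow> a \<sqsubseteq> x \<Longrightarrow> a \<sqsubseteq> y" shows "x \<sqsubseteq> y"
proof -
  have "meet A x (\<sim> y) = bot A"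
  proof (rule ccontr)
    assume "meet A x (\<sim> y) \<noteq> bot A"
    then obtain a where a: "a \<in> At" "a \<sqsubseteq> meet A x (\<sim> y)" using ex_atom_below[of "meet A x (\<sim> y)"] assms by auto
    hence "a \<sqsubseteq> x" "a \<sqsubseteq> \<sim> y"
      using assms le_trans[OF _ _ _ a(2)] meet_le1[of x "\<sim> y"] meet_le2[of x "\<sim> y"] by auto
    thus False using a assms by (simp add: atom_le_compl)
  qed
  thus ?thesis using plus_meet[of x y] meet_le2[of x y] assms by simp
qed

text \<open>Infinite distributivity is avoided: if no atom below \<open>y\<close> were below
  \<open>x\<^sup>c \<odot> c\<close>, then \<open>y\<close> would lie below the complement of that
  product, and \<open>peirce\<close> would put \<open>x \<odot> y\<close> below
  \<open>\<sim> c\<close>.\<close>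

lemma cmp_atom_right:
  assumes "x \<in> K" "y \<in> K" "c \<in> At" "c \<sqsubseteq> x \<odot> y"
  obtains b where "b \<in> At" "b \<sqsubseteq> y" "c \<sqsubseteq> x \<odot> b"
proof -
  have "\<exists>b\<in>At. b \<sqsubseteq> y \<and> b \<sqsubseteq> x\<^sup>c \<odot> c"
  proof (rule ccontr)
    assume "\<not> ?thesis"
    hence "y \<sqsubseteq> \<sim> (x\<^sup>c \<odot> c)" using assms le_if_atoms_le[of y "\<sim> (x\<^sup>c \<odot> c)"] by (auto simp: atom_le_compl)
    hence "x\<^sup>c \<odot> c \<sqsubseteq> \<sim> y" using assms by (subst compl_le_iff) auto
    hence "x \<odot> y \<sqsubseteq> \<sim> c" using peirce[of "x\<^sup>c" c y] assms by simp
    hence "c \<sqsubseteq> \<sim> c" using assms le_trans[of c "x \<odot> y" "\<sim> c"] by simp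
    thus False using assms by (simp add: atom_le_compl)
  qed
  then obtain b where "b \<in> At" "b \<sqsubseteq> y" "b \<sqsubseteq> x\<^sup>c \<odot> c" by blast
  moreover have "c \<sqsubseteq> x \<odot> b" using atom_peirce[of "x\<^sup>c" c b] calculation assms by simp
  ultimately show ?thesis using that by blast
qed

text \<open>\<open>cmp_atom_right\<close> is applied to the right factor and then, after taking
  converses, to the left one.\<close>

lemma cmp_atoms:
  assumes "x \<in> K" "y \<in> K" "c \<in> At" "c \<sqsubseteq> x \<odot> y"
  obtains a b where "a \<sqsubseteq> x" "b \<sqsubseteq> y" "C a b c"
proof -
  obtain b where b: "b \<in> At" "b \<sqsubseteq> y" "c \<sqsubseteq> x \<odot> b" using cmp_atom_right[OF assms] .
  have "c\<^sup>c \<sqsubseteq> b\<^sup>c \<odot> x\<^sup>c" using assms b cnv_mono[of c "x \<odot> b"] by (simp add: cnv_cmp)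
  then obtain a where a: "a \<in> At" "a \<sqsubseteq> x\<^sup>c" "c\<^sup>c \<sqsubseteq> b\<^sup>c \<odot> a"
    using cmp_atom_right[of "b\<^sup>c" "x\<^sup>c" "c\<^sup>c"] assms b by auto
  hence "C (b\<^sup>c) a (c\<^sup>c)" using assms b by (simp add: C_def)
  hence "C (a\<^sup>c) b c" using C_cnv[of "b\<^sup>c" a "c\<^sup>c"] assms b by simp
  moreover have "a\<^sup>c \<sqsubseteq> x" using a assms by (simp add: cnv_le_iff)
  ultimately show ?thesis using that b by blast
qed

text \<open>Splitting \<open>e \<odot> one\<close> yields an \<open>f\<close> in \<open>I\<close>
  with \<open>C e f e\<close>. As \<open>e\<close> acts as a left identity, \<open>f = e\<close>,
  and exchanging two corners of this triangle gives the claim.\<close>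

lemma cnv_I [simp]:
  assumes "e \<in> I" shows "e\<^sup>c = e"
proof -
  have "e \<sqsubseteq> e \<odot> one" using assms by (simp add: cmp_one_right)
  then obtain f where f: "f \<in> At" "f \<sqsubseteq> one" "e \<sqsubseteq> e \<odot> f"
    using cmp_atom_right[of e one e] assms by auto
  hence "C e f e" "f \<in> I" using assms I_intro[of f] by (auto simp: C_def)
  moreover hence "f = e" using assms C_I_left by blast
  ultimately have "C (e\<^sup>c) e e" using C_peirce by blast
  thus ?thesis using C_I_right[OF assms] by blast
qed

lemma ex_dom:
  assumes "a \<in> At" obtains e where "e \<in> I" "C e a a"
proof -
  have "a \<sqsubseteq> one \<odot> a" using assms by (simp add: cmp_one_left)
  then obtain e b where "e \<sqsubseteq> one" "b \<sqsubseteq> a" "C e b a" using cmp_atoms[of one a a] assms by auto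
  moreover hence "b = a" using assms atom_le_atom C_atoms by blast
  ultimately show ?thesis using that C_atoms I_intro by blast
qed

text \<open>The only place where the weak associativity axiom is used.\<close>

lemma C_dom:
  assumes "C a b c" "e \<in> I" "C e a a" shows "C e c c"
proof -
  have at: "a \<in> At" "b \<in> At" "c \<in> At" "e \<in> At" using assms C_atoms by auto
  have me: "meet A e one = e"
    using assms meet_le1[of e one] meet_greatest[of e one e] by (intro le_antisym) (auto simp: I_le_one)
  have "a \<sqsubseteq> e \<odot> top A"
    using assms at cmp_mono_right[of a "top A" e] le_trans[of a "e \<odot> a" "e \<odot> top A"] by (auto simp: C_def)
  \<comment> \<open>By weak associativity, multiplying \<open>e \<odot> top A\<close> by
    \<open>top A\<close> on the right does not enlarge it, so that it bounds
    \<open>a \<odot> b\<close> as well as \<open>a\<close>.\<close>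
  hence "a \<odot> b \<sqsubseteq> e \<odot> top A \<odot> top A" using at by (intro cmp_mono) auto
  also have "e \<odot> top A \<odot> top A = e \<odot> top A" using weak_assoc[of e] me at by simp
  finally have "c \<sqsubseteq> e \<odot> top A" using assms at le_trans[of c "a \<odot> b"] by (auto simp: C_def)
  then obtain b' where b': "b' \<in> At" "c \<sqsubseteq> e \<odot> b'" using cmp_atom_right[of e "top A" c] at by auto
  hence "C e b' c" using at by (simp add: C_def)
  moreover hence "b' = c" using assms C_I_left by blast
  ultimately show ?thesis by simp
qed

text \<open>The product of \<open>c\<close> and its converse has \<open>e\<close> below it, so
  \<open>C_dom\<close> carries the left identity \<open>f\<close> of \<open>c\<close> over to
  \<open>e\<close>.\<close>

lemma C_dom_unique:
  assumes "e \<in> I" "C e c c" "f \<in> I" "C f c c" shows "e = f"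
proof -
  have "C c (c\<^sup>c) e" using assms C_peirce' by blast
  hence "C f e e" using assms C_dom by blast
  thus ?thesis using C_I_right assms by blast
qed

text \<open>The label of the loop at the start of an edge labelled \<open>a\<close>;
  \<open>C_dom_unique\<close> makes the choice determinate on atoms.\<close>

definition dm :: "'a \<Rightarrow> 'a" where "dm a = (SOME e. e \<in> I \<and> C e a a)"
definition rn :: "'a \<Rightarrow> 'a" where "rn a = dm (a\<^sup>c)"

lemma dm: assumes "a \<in> At" shows "dm a \<in> I" "C (dm a) a a"
  using someI_ex[of "\<lambda>e. e \<in> I \<and> C e a a"] ex_dom[OF assms] unfolding dm_def by blast+

lemma dm_eq: assumes "e \<in> I" "C e a a" shows "dm a = e"
  using C_dom_unique[OF dm assms] C_atoms(2)[OF assms(2)] by blast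

lemma rn: assumes "a \<in> At" shows "rn a \<in> I" "C a (rn a) a"
proof -
  show "rn a \<in> I" unfolding rn_def using dm assms by blast
  have "C (dm (a\<^sup>c)) (a\<^sup>c) (a\<^sup>c)" "dm (a\<^sup>c) \<in> I" using dm assms by auto
  from C_cnv[OF this(1)] this(2) show "C a (rn a) a" using assms by (simp add: rn_def)
qed

lemma rn_cnv: "a \<in> At \<Longrightarrow> rn (a\<^sup>c) = dm a"
  by (simp add: rn_def)

lemma C_dm_cnv: "a \<in> At \<Longrightarrow> C a (a\<^sup>c) (dm a)"
  using C_peirce'[OF dm(2)] by blast

lemma dm_I: "e \<in> I \<Longrightarrow> dm e = e"
  by (metis C_I_right I_atom dm cnv_I rn rn_def)

lemma rn_I: "e \<in> I \<Longrightarrow> rn e = e"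
  by (simp add: rn_def dm_I)

text \<open>\<open>C_dom\<close> settles corner 0, and the symmetries of \<open>C\<close> settle the
  other two. Thus the loop at a corner of a triangle does not depend on the edge from which it is
  read.\<close>

lemma C_dm: assumes "C a b c" shows "dm a = dm c" "rn a = dm b" "rn b = rn c"
proof -
  have d: "dm a = dm c" if "C a b c" for a b c
    using dm_eq[of "dm a" c] C_dom[OF that] dm C_atoms[OF that] by simp
  show "dm a = dm c" using d assms .
  show "rn a = dm b" using d[OF C_peirce[OF assms]] by (simp add: rn_def)
  show "rn b = rn c" using d[OF C_cnv[OF assms]] by (simp add: rn_def)
qed

end

section \<open>A free model\<close>

text \<open>The name of a point is its history: \<open>New x y a b\<close> is attached to the edge
  from \<open>x\<close> to \<open>y\<close>, with \<open>a\<close> leading from \<open>x\<close> to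
  it and \<open>b\<close> from it to \<open>y\<close>, so different attachments never coincide. The
  label of the old edge is not recorded, being unique by \<open>lab_unique\<close>. Malformed names
  remain unrelated under \<open>lab\<close>.\<close>

datatype 'a pt = Root 'a | New "'a pt" "'a pt" 'a 'a

context atomic_wa
begin

text \<open>A subidentity \<open>a\<close> or \<open>b\<close> is excluded because it would force
  the new point to equal \<open>x\<close> or \<open>y\<close>. The loop \<open>rn a\<close> at the
  new point is also \<open>dm b\<close>, by \<open>C_dm\<close>.\<close>

inductive lab :: "'a pt \<Rightarrow> 'a pt \<Rightarrow> 'a \<Rightarrow> bool" where
  root: "e \<in> I \<Longrightarrow> lab (Root e) (Root e) e"
| xz: "lab x y c \<Longrightarrow> C a b c \<Longrightarrow> a \<notin> I \<Longrightarrow> b \<notin> I \<Longrightarrow> lab x (New x y a b) a"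
| zx: "lab x y c \<Longrightarrow> C a b c \<Longrightarrow> a \<notin> I \<Longrightarrow> b \<notin> I \<Longrightarrow> lab (New x y a b) x (a\<^sup>c)"
| zy: "lab x y c \<Longrightarrow> C a b c \<Longrightarrow> a \<notin> I \<Longrightarrow> b \<notin> I \<Longrightarrow> lab (New x y a b) y b"
| yz: "lab x y c \<Longrightarrow> C a b c \<Longrightarrow> a \<notin> I \<Longrightarrow> b \<notin> I \<Longrightarrow> lab y (New x y a b) (b\<^sup>c)"
| zz: "lab x y c \<Longrightarrow> C a b c \<Longrightarrow> a \<notin> I \<Longrightarrow> b \<notin> I \<Longrightarrow> lab (New x y a b) (New x y a b) (rn a)"

text \<open>Every edge between distinct points joins a new point to one that it was attached to.
  Orienting it from old to new makes \<open>size\<close> grow, which rules out cycles.\<close>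

definition child :: "'a pt \<Rightarrow> 'a pt \<Rightarrow> 'a \<Rightarrow> bool" where
  "child u z d \<longleftrightarrow> (\<exists>x y a b c. z = New x y a b \<and> lab x y c \<and> C a b c \<and> a \<notin> I \<and> b \<notin> I \<and>
     (u = x \<and> d = a \<or> u = y \<and> d = b\<^sup>c))"

lemma child_size: "child u z d \<Longrightarrow> size u < size z"
  by (auto simp: child_def)

lemma child_asym: "child u v c \<Longrightarrow> \<not> child v u d"
  using child_size less_asym by blast

lemma lab_atom: "lab u v c \<Longrightarrow> c \<in> At"
  by (induction rule: lab.induct) (auto dest: C_atoms rn(1))

lemma cnv_notin_I: "a \<in> At \<Longrightarrow> a \<notin> I \<Longrightarrow> a\<^sup>c \<notin> I"
  by (metis atom_closed cnv_I_closed cnv_cnv)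

lemma child_atom:
  assumes "child u z d" shows "d \<in> At" "d \<notin> I"
  using assms cnv_notin_I unfolding child_def by (auto dest: C_atoms)

lemma lab_child: "child u z d \<Longrightarrow> lab u z d"
  by (auto simp: child_def intro: lab.intros)

lemma lab_child':
  assumes "child u z d" shows "lab z u (d\<^sup>c)"
proof -
  obtain x y a b c where z: "z = New x y a b" "lab x y c" "C a b c" "a \<notin> I" "b \<notin> I"
    and u: "u = x \<and> d = a \<or> u = y \<and> d = b\<^sup>c" using assms unfolding child_def by blast
  have "b\<^sup>c\<^sup>c = b" using z C_atoms by simp
  thus ?thesis using u zx[OF z(2-5)] zy[OF z(2-5)] z(1) by auto
qed

lemma lab_cases:
  assumes "lab u v c"
  obtains "u = v" "c \<in> I" | "child u v c" | "child v u (c\<^sup>c)"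
  using assms
proof cases
  case (xz y d b)
  thus ?thesis using that(2) unfolding child_def by blast
next
  case (zx y d a b)
  thus ?thesis using that(3) C_atoms unfolding child_def by (metis atom_closed cnv_cnv)
next
  case (zy x d a)
  thus ?thesis using that(3) unfolding child_def by blast
next
  case (yz x d a b)
  thus ?thesis using that(2) unfolding child_def by blast
next
  case (zz x y d a b)
  thus ?thesis using that(1) rn(1) C_atoms by blast
qed (use that in blast)

lemma lab_sym: assumes "lab u v c" shows "lab v u (c\<^sup>c)"
  using assms
proof (cases rule: lab_cases)
  case 3
  thus ?thesis using lab_child by blast
qed (use assms lab_child' in auto)

lemma lab_same: "lab u u c \<Longrightarrow> c \<in> I"
  by (erule lab_cases) (auto dest: child_size)

lemma lab_I: "lab u v c \<Longrightarrow> c \<in> I \<Longrightarrow> u = v"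
  by (erule lab_cases) (auto dest: child_atom)

lemma lab_ends:
  assumes "lab u v c" shows "lab u u (dm c)" "lab v v (rn c)"
proof -
  have "lab u u (dm c) \<and> lab v v (rn c)"
    using assms
  proof (induction rule: lab.induct)
    case (root e)
    thus ?case by (simp add: dm_I rn_I lab.root)
  next
    case (xz x y c a b)
    thus ?case using C_dm[OF xz(2)] lab.zz[OF xz(1-4)] by simp
  next
    case (zx x y c a b)
    thus ?case using C_dm[OF zx(2)] C_atoms[OF zx(2)] lab.zz[OF zx(1-4)] by (simp add: rn_def)
  next
    case (zy x y c a b)
    thus ?case using C_dm[OF zy(2)] C_atoms[OF zy(2)] lab.zz[OF zy(1-4)] by simp
  next
    case (yz x y c a b)
    thus ?case using C_dm[OF yz(2)] C_atoms[OF yz(2)] lab.zz[OF yz(1-4)] by (simp add: rn_cnv) (simp add: rn_def)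
  next
    case (zz x y c a b)
    have "rn a \<in> I" using zz rn(1) C_atoms by blast
    thus ?case using lab.zz[OF zz(1-4)] by (simp add: dm_I rn_I)
  qed
  thus "lab u u (dm c)" "lab v v (rn c)" by auto
qed

lemma New_acyclic: "x \<noteq> New x y a b" "y \<noteq> New x y a b"
  by (auto dest: arg_cong[where f = size])

lemma lab_same_unique:
  assumes "lab u u c" "lab u u d" shows "c = d"
proof -
  have "d = (case u of Root e \<Rightarrow> e | New x y a b \<Rightarrow> rn a)" if "lab u v d" "u = v" for v d
    using that by (induction rule: lab.induct) (auto simp: New_acyclic New_acyclic[symmetric])
  thus ?thesis using assms by metis
qed

lemma child_unique:
  assumes "child u z c" "child u z d" shows "c = d"
proof -
  obtain x y a b k where z: "z = New x y a b" "lab x y k" "C a b k"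
    using assms(1) unfolding child_def by blast
  have "c \<in> {a, b\<^sup>c}" "d \<in> {a, b\<^sup>c}" using assms z unfolding child_def by auto
  \<comment> \<open>Only a point attached to a loop gets two labels for the same pair; then
    \<open>k\<close> is a subidentity and forces these labels to agree.\<close>
  moreover have "a = b\<^sup>c" if "x = y"
  proof -
    have "k \<in> I" using z that lab_same by blast
    thus ?thesis using C_I_left[OF _ C_peirce'[OF z(3)]] by metis
  qed
  ultimately show ?thesis using assms z unfolding child_def by auto
qed

lemma lab_unique:
  assumes "lab u v c" "lab u v d" shows "c = d"
proof -
  have k: "c \<in> K" "d \<in> K" using assms lab_atom by blast+
  show ?thesis
    using assms(1)
  proof (cases rule: lab_cases)
    case 1
    thus ?thesis using assms lab_same_unique by blast
  next
    case 2
    from assms(2) show ?thesis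
    proof (cases rule: lab_cases)
      case 2
      thus ?thesis using \<open>child u v c\<close> child_unique by blast
    qed (use 2 child_asym in blast)+
  next
    case 3
    from assms(2) show ?thesis
    proof (cases rule: lab_cases)
      case 3
      thus ?thesis using \<open>child v u (c\<^sup>c)\<close> child_unique k by (metis cnv_cnv)
    qed (use 3 child_asym in blast)+
  qed
qed

text \<open>The two older corners are the ends of the edge that \<open>w\<close> was attached to, in
  one order or the other, so the triangle is the one used in the construction or its
  converse.\<close>

lemma triangle_top:
  assumes "child u w a" "child v w d" "u \<noteq> v" "lab u v c" shows "C a (d\<^sup>c) c"
proof -
  obtain x y a0 b0 k where z: "w = New x y a0 b0" "lab x y k" "C a0 b0 k"
    using assms(1) unfolding child_def by blast
  have u: "u = x \<and> a = a0 \<or> u = y \<and> a = b0\<^sup>c" and v: "v = x \<and> d = a0 \<or> v = y \<and> d = b0\<^sup>c"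
    using assms z unfolding child_def by auto
  show ?thesis
  proof (cases "u = x \<and> a = a0")
    case True
    hence v': "v = y" "d = b0\<^sup>c" using v assms by auto
    hence "c = k" using True assms z lab_unique by blast
    thus ?thesis using v' True z C_atoms[OF z(3)] by simp
  next
    case False
    hence u': "u = y" "a = b0\<^sup>c" using u by auto
    hence v': "v = x" "d = a0" using v assms by auto
    hence "c = k\<^sup>c" using u' assms z lab_unique lab_sym by blast
    thus ?thesis using u' v' z C_cnv by blast
  qed
qed

text \<open>Degenerate triangles are settled by the loops. Otherwise \<open>size\<close> singles out
  a newest corner, and \<open>triangle_top\<close> applies there, up to a symmetry of
  \<open>C\<close>.\<close>

lemma lab_triangle:
  assumes "lab u v c" "lab u w a" "lab w v b" shows "C a b c"
proof -
  note at = assms[THEN lab_atom]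
  consider "u = w" | "w = v" | "u = v" | "u \<noteq> w" "w \<noteq> v" "u \<noteq> v" by blast
  thus ?thesis
  proof cases
    case 1
    hence "a = dm c" "b = c" using assms lab_unique lab_ends by blast+
    thus ?thesis using dm at by simp
  next
    case 2
    hence "b = rn c" "a = c" using assms lab_unique lab_ends by blast+
    thus ?thesis using rn at by simp
  next
    case 3
    hence "c = dm a" "b = a\<^sup>c" using assms lab_unique lab_ends lab_sym by blast+
    thus ?thesis using C_dm_cnv at by simp
  next
    case 4
    have c: "child u v c \<or> child v u (c\<^sup>c)" using lab_cases[OF assms(1)] 4 by blast
    have a: "child u w a \<or> child w u (a\<^sup>c)" using lab_cases[OF assms(2)] 4 by blast
    have b: "child w v b \<or> child v w (b\<^sup>c)" using lab_cases[OF assms(3)] 4 by blast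
    have w: ?thesis if "child u w a" "child v w (b\<^sup>c)"
      using triangle_top[OF that 4(3) assms(1)] at by simp
    have v: ?thesis if "child u v c" "child w v b"
      using C_peirce'[OF triangle_top[OF that 4(1) assms(2)]] at by simp
    have u: ?thesis if "child w u (a\<^sup>c)" "child v u (c\<^sup>c)"
      using C_peirce[OF triangle_top[OF that 4(2) assms(3)]] at by simp
    show ?thesis using a b c u v w
      by (metis child_size less_asym less_trans)
  qed
qed

text \<open>A subidentity label calls for no new point: \<open>x\<close> or \<open>y\<close> itself
  serves.\<close>

lemma lab_extend:
  assumes "lab x y c" "C a b c" obtains z where "lab x z a" "lab z y b"
proof -
  consider "a \<in> I" | "b \<in> I" | "a \<notin> I" "b \<notin> I" by blast
  thus ?thesis
  proof cases
    case 1
    hence "b = c" "a = dm c" using assms C_I_left C_dm(1) dm_I by metis+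
    thus ?thesis using that assms lab_ends by blast
  next
    case 2
    hence "a = c" "b = rn c" using assms C_I_right C_dm(3) rn_I by metis+
    thus ?thesis using that assms lab_ends by blast
  next
    case 3
    thus ?thesis using that assms xz zy by blast
  qed
qed

text \<open>The edge is grown on the root loop labelled \<open>dm a\<close>, using
  \<open>C_dm_cnv\<close>.\<close>

lemma ex_lab:
  assumes "a \<in> At" obtains x y where "lab x y a"
  using lab_extend[OF root[OF dm(1)] C_dm_cnv] assms by blast

end

section \<open>Mapping trails to the free model\<close>

lemma trails_iff:
  "p \<in> trails A \<longleftrightarrow> p \<noteq> [] \<and> (\<forall>x\<in>set p. fst x \<in> SB A \<and> snd x < 3) \<and>
     successively (\<lambda>x y. fst x \<noteq> fst y \<and> cmpnt (fst x) (snd x) = cmpnt (fst y) (snd x)) p"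
proof -
  have "(\<forall>i < length p. fst (p ! i) \<in> SB A \<and> snd (p ! i) < 3) \<longleftrightarrow> (\<forall>x\<in>set p. fst x \<in> SB A \<and> snd x < 3)"
    by (metis in_set_conv_nth)
  moreover have "(\<forall>i. Suc i < length p \<longrightarrow> fst (p ! i) \<noteq> fst (p ! Suc i) \<and>
            (fst (p ! i), fst (p ! Suc i)) \<in> ST A (snd (p ! i))) \<longleftrightarrow>
      successively (\<lambda>x y. fst x \<noteq> fst y \<and> cmpnt (fst x) (snd x) = cmpnt (fst y) (snd x)) p"
    if "\<forall>i < length p. fst (p ! i) \<in> SB A \<and> snd (p ! i) < 3"
    using that by (auto simp: successively_conv_nth ST_def)
  ultimately show ?thesis unfolding trails_def by blast
qed

text \<open>Lists are read here with the latest step first, so the trail visits \<open>z\<close>,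
  \<open>y\<close>, \<open>x\<close> in this order; the excluded pattern is the one that rule (a)
  cancels.\<close>

fun reduced :: "'a trail \<Rightarrow> bool" where
  "reduced (x # y # z # r) \<longleftrightarrow> \<not> (fst x = fst z \<and> snd y = snd z) \<and> reduced (y # z # r)"
| "reduced _ \<longleftrightarrow> True"

text \<open>On backtracking to \<open>t\<close> the earlier visit \<open>z\<close> is dropped too,
  since \<open>push\<close> puts \<open>t\<close> back with its new index.\<close>

fun trim :: "'a trail \<Rightarrow> 'a triple \<Rightarrow> 'a trail" where
  "trim (y # z # r) t = (if t = fst z \<and> snd y = snd z then r else y # z # r)"
| "trim r t = r"

definition push :: "'a trail \<Rightarrow> 'a triple \<times> nat \<Rightarrow> 'a trail" where
  "push r x = x # trim r (fst x)"

text \<open>The normal form of a trail under the cancellation rule (a), in reverse order.\<close>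

definition stack :: "'a trail \<Rightarrow> 'a trail" where
  "stack p = foldl push [] p"

lemma stack_snoc: "stack (p @ [x]) = push (stack p) x"
  by (simp add: stack_def)

lemma reduced_change_hd: "reduced (z # r) \<Longrightarrow> fst x = fst z \<Longrightarrow> reduced (x # r)"
  by (cases "z # r" rule: reduced.cases) auto

lemma reduced_push: "reduced r \<Longrightarrow> reduced (push r x)"
proof (cases r rule: reduced.cases)
  case (1 y z w r')
  assume "reduced r"
  thus ?thesis using 1 reduced_change_hd[of z "w # r'" x] by (auto simp: push_def)
qed (auto simp: push_def)

lemma push_cancel:
  assumes "reduced r"
  shows "push (push (push r (t, l)) (s, l)) (t, k) = push r (t, k)"
proof -
  define r' where "r' = trim r t"
  have red: "reduced ((t, l) # r')" using reduced_push[OF assms, of "(t, l)"] by (simp add: push_def r'_def)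
  have "trim ((s, l) # trim ((t, l) # r') s) t = r'"
  proof (cases "\<exists>q. r' = (s, l) # q")
    \<comment> \<open>Here the push of \<open>s\<close> cancels as well and leaves
      \<open>r'\<close>. Reducedness of \<open>(t, l) # r'\<close> keeps the following push of
      \<open>t\<close> from cancelling deeper.\<close>
    case True
    then obtain q where "r' = (s, l) # q" by blast
    thus ?thesis using red by (cases q) auto
  next
    case False
    hence "trim ((t, l) # r') s = (t, l) # r'" by (cases r') auto
    thus ?thesis by simp
  qed
  thus ?thesis by (simp add: push_def r'_def)
qed

text \<open>The order is reversed, so the common face of two neighbours is named by the index of the
  second one.\<close>

definition face_path :: "'a ra_alg \<Rightarrow> 'a trail \<Rightarrow> bool" where
  "face_path A r \<longleftrightarrow> (\<forall>x\<in>set r. fst x \<in> SB A \<and> snd x < 3) \<and>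
     successively (\<lambda>y x. cmpnt (fst x) (snd x) = cmpnt (fst y) (snd x)) r"

lemma face_path_Cons:
  "face_path A (x # r) \<longleftrightarrow> fst x \<in> SB A \<and> snd x < 3 \<and> face_path A r \<and>
     (r = [] \<or> cmpnt (fst (hd r)) (snd (hd r)) = cmpnt (fst x) (snd (hd r)))"
  by (cases r) (auto simp: face_path_def)

lemma face_path_push:
  assumes "face_path A (x # r)" shows "face_path A (push r x)"
  using assms by (cases "(r, fst x)" rule: trim.cases) (auto simp: push_def face_path_Cons)

lemma stack_trail:
  "p \<in> trails A \<Longrightarrow> face_path A (stack p) \<and> reduced (stack p) \<and> stack p \<noteq> [] \<and> hd (stack p) = last p"
proof (induction p rule: rev_induct)
  case (snoc x p)
  show ?case
  proof (cases "p = []")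
    case True
    thus ?thesis using snoc.prems by (simp add: stack_def push_def trails_iff face_path_def)
  next
    case False
    hence p: "p \<in> trails A" and x: "fst x \<in> SB A" "snd x < 3"
        "cmpnt (fst (last p)) (snd (last p)) = cmpnt (fst x) (snd (last p))"
      using snoc.prems by (auto simp: trails_iff successively_append_iff)
    from snoc.IH[OF p] x have "face_path A (x # stack p)" by (simp add: face_path_Cons)
    thus ?thesis using snoc.IH[OF p] by (simp add: stack_snoc face_path_push reduced_push) (simp add: push_def)
  qed
qed (simp add: trails_iff)

section \<open>Realising the triangles along a trail\<close>

context atomic_wa
begin

lemma SB_iff: "t \<in> SB A \<longleftrightarrow> C (cmpnt t 2) (cmpnt t 0) (cmpnt t 1)"
  by (auto simp: SB_def C_def)

definition realises :: "(nat \<Rightarrow> 'a pt) \<Rightarrow> 'a triple \<Rightarrow> bool" where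
  "realises f t \<longleftrightarrow> lab (f 1) (f 2) (cmpnt t 0) \<and> lab (f 0) (f 2) (cmpnt t 1) \<and> lab (f 0) (f 1) (cmpnt t 2)"

lemma lt3: "(k::nat) < 3 \<Longrightarrow> k = 0 \<or> k = 1 \<or> k = 2"
  by auto

lemma ex_realises:
  assumes "t \<in> SB A" shows "\<exists>f. realises f t"
proof -
  have c: "C (cmpnt t 2) (cmpnt t 0) (cmpnt t 1)" using assms SB_iff by blast
  then obtain x z where xz: "lab x z (cmpnt t 1)" using ex_lab C_atoms by metis
  then obtain y where "lab x y (cmpnt t 2)" "lab y z (cmpnt t 0)" using lab_extend c by blast
  thus ?thesis using xz by (intro exI[of _ "\<lambda>i. if i = 0 then x else if i = 1 then y else z"])
      (simp add: realises_def)
qed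

text \<open>Component \<open>k\<close> labels the edge opposite to corner \<open>k\<close>, so
  crossing this face moves corner \<open>k\<close> only. \<open>lab_extend\<close> supplies its new
  place, once \<open>C\<close> is turned so that the common edge stands third.\<close>

lemma realises_extend:
  assumes f: "realises f t" and s: "s \<in> SB A" and k: "k < 3" "cmpnt s k = cmpnt t k"
  shows "\<exists>g. realises g s \<and> (\<forall>i. i \<noteq> k \<longrightarrow> g i = f i)"
proof -
  have c: "C (cmpnt s 2) (cmpnt s 0) (cmpnt s 1)" using s SB_iff by blast
  note at = C_atoms[OF c]
  consider "k = 0" | "k = 1" | "k = 2" using lt3[OF k(1)] by blast
  then obtain z where "realises (f(k := z)) s"
  proof cases
    case 1
    have l: "lab (f 1) (f 2) (cmpnt s 0)" using f k 1 by (simp add: realises_def)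
    obtain z where z: "lab (f 1) z ((cmpnt s 2)\<^sup>c)" "lab z (f 2) (cmpnt s 1)"
      using lab_extend[OF l C_peirce[OF c]] by blast
    have "lab z (f 1) (cmpnt s 2)" using lab_sym[OF z(1)] at by simp
    thus ?thesis using that[of z] l z 1 by (simp add: realises_def)
  next
    case 2
    have l: "lab (f 0) (f 2) (cmpnt s 1)" using f k 2 by (simp add: realises_def)
    obtain z where "lab (f 0) z (cmpnt s 2)" "lab z (f 2) (cmpnt s 0)"
      using lab_extend[OF l c] by blast
    thus ?thesis using that[of z] l 2 by (simp add: realises_def)
  next
    case 3
    have l: "lab (f 0) (f 1) (cmpnt s 2)" using f k 3 by (simp add: realises_def)
    obtain z where z: "lab (f 0) z (cmpnt s 1)" "lab z (f 1) ((cmpnt s 0)\<^sup>c)"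
      using lab_extend[OF l C_peirce'[OF c]] by blast
    have "lab (f 1) z (cmpnt s 0)" using lab_sym[OF z(2)] at by simp
    thus ?thesis using that[of z] l z 3 by (simp add: realises_def)
  qed
  thus ?thesis by (intro exI[of _ "f(k := z)"]) simp
qed

text \<open>The newest triangle is placed so as to agree with the one before it except at the corner
  opposite to the crossed face. The index of the newest step does not enter, as
  \<open>pos_change_hd\<close> records. Stacks of trails are nonempty, so the first equation is a
  mere default.\<close>

fun pos :: "'a trail \<Rightarrow> nat \<Rightarrow> 'a pt" where
  "pos [] = undefined"
| "pos [x] = (SOME f. realises f (fst x))"
| "pos (x # y # r) = (SOME g. realises g (fst x) \<and> (\<forall>i. i \<noteq> snd y \<longrightarrow> g i = pos (y # r) i))"

lemma pos_change_hd: "fst x = fst y \<Longrightarrow> pos (x # r) = pos (y # r)"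
  by (cases r) auto

lemma pos_step:
  assumes "face_path A (x # y # r)" "realises (pos (y # r)) (fst y)"
  shows "realises (pos (x # y # r)) (fst x) \<and> (\<forall>i. i \<noteq> snd y \<longrightarrow> pos (x # y # r) i = pos (y # r) i)"
proof -
  have "\<exists>g. realises g (fst x) \<and> (\<forall>i. i \<noteq> snd y \<longrightarrow> g i = pos (y # r) i)"
    using assms by (intro realises_extend[of _ "fst y"]) (auto simp: face_path_Cons simp del: pos.simps)
  from someI_ex[OF this] show ?thesis by simp
qed

lemma pos_realises: "face_path A (x # r) \<Longrightarrow> realises (pos (x # r)) (fst x)"
proof (induction r arbitrary: x)
  case Nil
  thus ?case using someI_ex[OF ex_realises[of "fst x"]] by (simp add: face_path_Cons)
next
  case (Cons y r)
  thus ?case using pos_step face_path_Cons by blast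
qed

declare pos.simps [simp del]

lemma pos_agree:
  assumes "face_path A (x # y # r)" "i \<noteq> snd y"
  shows "pos (x # y # r) i = pos (y # r) i"
  using assms pos_step pos_realises face_path_Cons by blast

text \<open>If the push cancels, \<open>x\<close> gets the place already chosen for
  \<open>z\<close>, and the place of \<open>y\<close> was chosen to agree with that one away from
  the same corner.\<close>

lemma pos_push:
  assumes "face_path A (x # y # r)" "i \<noteq> snd y"
  shows "pos (push (y # r) x) i = pos (y # r) i"
proof (cases "\<exists>z q. r = z # q \<and> fst x = fst z \<and> snd y = snd z")
  case True
  then obtain z q where r: "r = z # q" "fst x = fst z" "snd y = snd z" by blast
  hence "pos (push (y # r) x) i = pos (z # q) i" by (simp add: push_def pos_change_hd[of x z])
  also have "\<dots> = pos (y # r) i"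
    using pos_agree[of y z q i] assms r face_path_Cons[of A x "y # r"] by simp
  finally show ?thesis .
next
  case False
  hence "push (y # r) x = x # y # r" by (cases r) (auto simp: push_def)
  thus ?thesis using pos_agree assms by simp
qed

text \<open>The last index of a trail names a corner, whereas the earlier ones name faces that are
  crossed.\<close>

definition pt_of :: "'a trail \<Rightarrow> 'a pt" where
  "pt_of p = pos (stack p) (snd (last p))"

lemma pos_stack_realises:
  assumes "p \<in> trails A" shows "realises (pos (stack p)) (fst (last p))"
  using pos_realises stack_trail[OF assms] by (metis list.collapse)

lemma realises_I:
  assumes "realises f t" "l < 3" "k < 3" "t \<in> SE A l k" shows "f l = f k"
proof (cases "l = k")
  case False
  let ?c = "cmpnt t (3 - k - l)"
  have "t \<in> SB A" "leq A (cmpnt t (3 - l - k)) one" using assms(4) False by (auto simp: SE_def)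
  hence "cmpnt t (3 - l - k) \<in> I"
    using lt3[OF assms(2)] lt3[OF assms(3)] False C_atoms by (auto simp: SB_iff numeral_2_eq_2 intro!: I_intro)
  thus ?thesis
    using lt3[OF assms(2)] lt3[OF assms(3)] False assms(1) lab_I[of "f 1" "f 2" "cmpnt t 0"]
      lab_I[of "f 0" "f 2" "cmpnt t 1"] lab_I[of "f 0" "f 1" "cmpnt t 2"] unfolding realises_def
    by (elim disjE) (auto simp: numeral_2_eq_2)
qed simp

text \<open>Under (a) the stack is unchanged, under (b) crossing face \<open>l\<close> fixes corner
  \<open>n\<close>, and under (c) the two corners are joined by a subidentity label and so are one
  point of the model.\<close>

lemma pt_of_gen:
  assumes "(p, q) \<in> trail_gen A" shows "pt_of p = pt_of q"
proof -
  have pq: "p \<in> trails A" "q \<in> trails A" using assms by (auto simp: trail_gen_def)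
  consider (a) pre post t k l s where "p = pre @ [(t, l), (s, l), (t, k)] @ post" "q = pre @ [(t, k)] @ post"
    | (b) pre t l s n where "l \<noteq> n" "p = pre @ [(t, l), (s, n)]" "q = pre @ [(t, n)]"
    | (c) pre t l k where "t \<in> SE A l k" "p = pre @ [(t, l)]" "q = pre @ [(t, k)]"
    using assms unfolding trail_gen_def by blast
  thus ?thesis
  proof cases
    case a
    have "reduced (stack pre)"
      using stack_trail[of pre A] pq(1) a
      by (cases "pre = []") (auto simp: trails_iff successively_append_iff stack_def)
    hence "stack p = stack q" using a push_cancel[of "stack pre" t l s k] by (simp add: stack_def)
    moreover have "last p = last q" using a by (cases "post = []") auto
    ultimately show ?thesis by (simp add: pt_of_def)
  next
    case b
    have 1: "pre @ [(t, l)] \<in> trails A" and s: "s \<in> SB A" "n < 3" "cmpnt t l = cmpnt s l"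
      using pq(1) b by (auto simp: trails_iff successively_append_iff)
    obtain r where r: "r = trim (stack pre) t" by blast
    have st: "stack (pre @ [(t, l)]) = (t, l) # r" by (simp add: stack_snoc push_def r)
    have "face_path A ((s, n) # (t, l) # r)"
      using stack_trail[OF 1] s unfolding st by (simp add: face_path_Cons[of _ "(s, n)"])
    hence "pos (push ((t, l) # r) (s, n)) n = pos ((t, l) # r) n" using pos_push b by simp
    moreover have "stack p = push ((t, l) # r) (s, n)"
      using stack_snoc[of "pre @ [(t, l)]" "(s, n)"] b st by simp
    moreover have "stack q = (t, n) # r" using b by (simp add: stack_snoc push_def r)
    ultimately show ?thesis using b pos_change_hd[of "(t, l)" "(t, n)" r] by (simp add: pt_of_def)
  next
    case c
    have "pos (stack p) = pos (stack q)"
      using c pos_change_hd[of "(t, l)" "(t, k)"] by (simp add: stack_snoc push_def)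
    moreover have "pos (stack p) l = pos (stack p) k"
      using c pq by (intro realises_I[OF pos_stack_realises]) (auto simp: trails_iff)
    ultimately show ?thesis using c by (simp add: pt_of_def)
  qed
qed

lemma pt_of_eq:
  assumes "(p, q) \<in> trail_eq A" shows "pt_of p = pt_of q"
proof -
  have "pt_of p = pt_of q" if "(p, q) \<in> (trail_gen A \<union> (trail_gen A)\<inverse>)\<^sup>+"
    using that by (induction rule: trancl_induct) (auto dest: pt_of_gen)
  thus ?thesis using assms by (auto simp: trail_eq_def)
qed

end

section \<open>The exchange of components\<close>

lemma trail_eq_sym: "(p, q) \<in> trail_eq A \<Longrightarrow> (q, p) \<in> trail_eq A"
proof -
  have "sym ((trail_gen A \<union> (trail_gen A)\<inverse>)\<^sup>+)"
    by (intro sym_trancl sym_Un_converse)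
  thus "(p, q) \<in> trail_eq A \<Longrightarrow> (q, p) \<in> trail_eq A"
    by (auto simp: trail_eq_def sym_def)
qed

lemma trail_eq_trans: "(p, q) \<in> trail_eq A \<Longrightarrow> (q, r) \<in> trail_eq A \<Longrightarrow> (p, r) \<in> trail_eq A"
  by (auto simp: trail_eq_def dest: trancl_trans)

lemma trail_eq_refl: "p \<in> trails A \<Longrightarrow> (p, p) \<in> trail_eq A"
  by (auto simp: trail_eq_def)

lemma trail_cls_eqI: "(p, q) \<in> trail_eq A \<Longrightarrow> trail_cls A p = trail_cls A q"
  using trail_eq_sym trail_eq_trans unfolding trail_cls_def by blast

lemma trail_cls_eqD: "trail_cls A p = trail_cls A q \<Longrightarrow> q \<in> trails A \<Longrightarrow> (p, q) \<in> trail_eq A"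
  using trail_eq_refl unfolding trail_cls_def by blast

lemma trail_cls_gen: "(p, q) \<in> trail_gen A \<Longrightarrow> trail_cls A p = trail_cls A q"
  by (rule trail_cls_eqI) (auto simp: trail_eq_def)

lemma trail_gen_cancel:
  "pre @ [(t, l), (s, l), (t, k)] @ post \<in> trails A \<Longrightarrow> pre @ [(t, k)] @ post \<in> trails A \<Longrightarrow>
    (pre @ [(t, l), (s, l), (t, k)] @ post, pre @ [(t, k)] @ post) \<in> trail_gen A"
  unfolding trail_gen_def mem_Collect_eq prod.case by blast

lemma trail_gen_cross:
  "pre @ [(t, l), (s, n)] \<in> trails A \<Longrightarrow> pre @ [(t, n)] \<in> trails A \<Longrightarrow> l \<noteq> n \<Longrightarrow>
    (pre @ [(t, l), (s, n)], pre @ [(t, n)]) \<in> trail_gen A"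
  unfolding trail_gen_def mem_Collect_eq prod.case by blast

lemma trail_gen_ident:
  "pre @ [(t, l)] \<in> trails A \<Longrightarrow> pre @ [(t, k)] \<in> trails A \<Longrightarrow> t \<in> SE A l k \<Longrightarrow>
    (pre @ [(t, l)], pre @ [(t, k)]) \<in> trail_gen A"
  unfolding trail_gen_def mem_Collect_eq prod.case by blast

definition corner :: "'a ra_alg \<Rightarrow> 'a trail \<Rightarrow> nat \<Rightarrow> 'a trail set" where
  "corner A p n = trail_cls A (set_last p n)"

definition edges :: "'a ra_alg \<Rightarrow> 'a \<Rightarrow> ('a trail set \<times> 'a trail set) set" where
  "edges A a = {(corner A p 0, corner A p 1) | p. p \<in> trails A \<and> cmpnt (fst (last p)) 2 = a}"

lemma set_last_simps [simp]:
  "set_last (p @ [x]) n = p @ [(fst x, n)]" "fst (last (set_last p n)) = fst (last p)"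
  "snd (last (set_last p n)) = n"
  by (auto simp: set_last_def)

lemma set_last_trails: "p \<in> trails A \<Longrightarrow> n < 3 \<Longrightarrow> set_last p n \<in> trails A"
  by (cases p rule: rev_cases) (auto simp: trails_iff successively_append_iff)

lemma corner_UB: "p \<in> trails A \<Longrightarrow> n < 3 \<Longrightarrow> corner A p n \<in> UB A"
  by (auto simp: corner_def UB_def set_last_trails)

lemma edges_subset: "edges A a \<subseteq> UB A \<times> UB A"
  by (auto simp: edges_def corner_UB)

lemma edges_01: "p \<in> trails A \<Longrightarrow> (corner A p 0, corner A p 1) \<in> edges A (cmpnt (fst (last p)) 2)"
  by (auto simp: edges_def)

lemma last_SB: "p \<in> trails A \<Longrightarrow> fst (last p) \<in> SB A"
  by (auto simp: trails_iff)

lemma single_trail: "t \<in> SB A \<Longrightarrow> [(t, 0)] \<in> trails A"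
  by (simp add: trails_iff)

text \<open>The counterpart of \<open>realises_extend\<close> for classes of trails. Rule (b) keeps
  the other corners. If \<open>s\<close> is already the last triangle, \<open>p\<close> itself
  serves, because consecutive triangles of a trail must differ.\<close>

lemma trail_extend:
  assumes p: "p \<in> trails A" and s: "s \<in> SB A" "k < 3" "cmpnt s k = cmpnt (fst (last p)) k"
  obtains q where "q \<in> trails A" "fst (last q) = s" "\<And>n. n < 3 \<Longrightarrow> n \<noteq> k \<Longrightarrow> corner A q n = corner A p n"
proof (cases "s = fst (last p)")
  case True
  thus ?thesis using that p by blast
next
  case False
  obtain r t j where r: "p = r @ [(t, j)]" using p by (cases p rule: rev_cases) (auto simp: trails_iff)
  have q: "r @ [(t, k), (s, n)] \<in> trails A" if "n < 3" for n
    using p s r that False by (auto simp: trails_iff successively_append_iff)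
  show ?thesis
  proof (rule that[of "r @ [(t, k), (s, 0)]"])
    fix n assume n: "n < 3" "n \<noteq> (k::nat)"
    have "(r @ [(t, k), (s, n)], r @ [(t, n)]) \<in> trail_gen A"
      using q[OF n(1)] n set_last_trails[OF p n(1)] r by (intro trail_gen_cross) auto
    moreover have "set_last (r @ [(t, k), (s, 0)]) n = r @ [(t, k), (s, n)]"
      by (simp add: set_last_def butlast_append)
    ultimately show "corner A (r @ [(t, k), (s, 0)]) n = corner A p n"
      using trail_cls_gen r by (simp add: corner_def)
  qed (use q in auto)
qed

lemma corner_identified:
  assumes "p \<in> trails A" "fst (last p) \<in> SE A l k" "l < 3" "k < 3"
  shows "corner A p l = corner A p k"
proof -
  obtain r t j where r: "p = r @ [(t, j)]" using assms by (cases p rule: rev_cases) (auto simp: trails_iff)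
  have "(set_last p l, set_last p k) \<in> trail_gen A"
    using assms set_last_trails[of p A] r by (auto intro: trail_gen_ident)
  thus ?thesis using trail_cls_gen by (simp add: corner_def)
qed

text \<open>Prefixing a step across the face \<open>k\<close> exchanges the components of the trails
  starting in \<open>s\<close> and in \<open>t\<close>.\<close>

definition swap :: "'a triple \<Rightarrow> 'a triple \<Rightarrow> nat \<Rightarrow> 'a trail \<Rightarrow> 'a trail" where
  "swap s t k p = (if fst (hd p) = t then (s, k) # p else if fst (hd p) = s then (t, k) # p else p)"

definition adjacent :: "'a ra_alg \<Rightarrow> 'a triple \<Rightarrow> 'a triple \<Rightarrow> nat \<Rightarrow> bool" where
  "adjacent A s t k \<longleftrightarrow> s \<in> SB A \<and> t \<in> SB A \<and> s \<noteq> t \<and> k < 3 \<and> cmpnt s k = cmpnt t k"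

lemma trails_nonempty: "p \<in> trails A \<Longrightarrow> p \<noteq> []"
  by (simp add: trails_iff)

lemma Cons_trails:
  "p \<in> trails A \<Longrightarrow> s \<in> SB A \<Longrightarrow> k < 3 \<Longrightarrow> s \<noteq> fst (hd p) \<Longrightarrow> cmpnt s k = cmpnt (fst (hd p)) k \<Longrightarrow>
    (s, k) # p \<in> trails A"
  by (cases p) (auto simp: trails_iff)

lemma swap_trails: "adjacent A s t k \<Longrightarrow> p \<in> trails A \<Longrightarrow> swap s t k p \<in> trails A"
  by (auto simp: swap_def adjacent_def intro!: Cons_trails)

lemma trail_gen_cases:
  assumes "(p, q) \<in> trail_gen A"
  obtains (cancel) pre post t k l s where
      "p = pre @ [(t, l), (s, l), (t, k)] @ post" "q = pre @ [(t, k)] @ post"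
  | (cross) pre t l s n where "l \<noteq> n" "p = pre @ [(t, l), (s, n)]" "q = pre @ [(t, n)]"
  | (ident) pre t l k where "t \<in> SE A l k" "p = pre @ [(t, l)]" "q = pre @ [(t, k)]"
  using assms unfolding trail_gen_def mem_Collect_eq prod.case by blast

lemma trail_gen_Cons:
  assumes "(p, q) \<in> trail_gen A" "x # p \<in> trails A" "x # q \<in> trails A"
  shows "(x # p, x # q) \<in> trail_gen A"
  using assms(1)
proof (cases rule: trail_gen_cases)
  case (cancel pre post t k l s)
  thus ?thesis using trail_gen_cancel[of "x # pre" t l s k post A] assms by simp
next
  case (cross pre t l s n)
  thus ?thesis using trail_gen_cross[of "x # pre" t l s n A] assms by simp
next
  case (ident pre t l k)
  thus ?thesis using trail_gen_ident[of "x # pre" t l A k] assms by simp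
qed

lemma trail_gen_hd: "(p, q) \<in> trail_gen A \<Longrightarrow> fst (hd p) = fst (hd q)"
  by (erule trail_gen_cases) (auto simp: hd_append)

text \<open>No rule changes the first triangle, so the same step is prefixed to both trails or to
  neither.\<close>

lemma swap_gen:
  assumes "adjacent A s t k" "(p, q) \<in> trail_gen A"
  shows "(swap s t k p, swap s t k q) \<in> trail_gen A"
proof -
  have "p \<in> trails A" "q \<in> trails A" using assms by (auto simp: trail_gen_def)
  hence "swap s t k p \<in> trails A" "swap s t k q \<in> trails A" using assms swap_trails by blast+
  thus ?thesis
    using assms(2) trail_gen_hd[OF assms(2)] trail_gen_Cons[OF assms(2)] unfolding swap_def
    by (auto split: if_splits)
qed

lemma swap_eq:
  assumes a: "adjacent A s t k" and "(p, q) \<in> trail_eq A"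
  shows "(swap s t k p, swap s t k q) \<in> trail_eq A"
proof -
  have "(swap s t k p, swap s t k q) \<in> (trail_gen A \<union> (trail_gen A)\<inverse>)\<^sup>+"
    if "(p, q) \<in> (trail_gen A \<union> (trail_gen A)\<inverse>)\<^sup>+"
    using that
  proof (induction rule: trancl_induct)
    case (base q)
    thus ?case using swap_gen[OF a] by blast
  next
    case (step q r)
    thus ?case using swap_gen[OF a] by (meson UnCI UnE converse_iff trancl.trancl_into_trancl)
  qed
  thus ?thesis using assms swap_trails[OF a] by (auto simp: trail_eq_def)
qed

text \<open>If steps are prefixed at all, they cross the face \<open>k\<close> back and forth, and
  rule (a) removes them.\<close>

lemma swap_swap:
  assumes a: "adjacent A s t k" and p: "p \<in> trails A"
  shows "(swap s t k (swap s t k p), p) \<in> trail_eq A"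
proof (cases "fst (hd p) \<in> {s, t}")
  case True
  define s' where "s' = (if fst (hd p) = t then s else t)"
  obtain t' j r where r: "p = (t', j) # r" using p by (cases p) (auto simp: trails_iff)
  have "swap s t k (swap s t k p) = [] @ [(t', k), (s', k), (t', j)] @ r"
    using a True by (auto simp: swap_def adjacent_def r s'_def)
  moreover have "swap s t k (swap s t k p) \<in> trails A" using swap_trails[OF a] p by blast
  ultimately have "(swap s t k (swap s t k p), p) \<in> trail_gen A"
    using p trail_gen_cancel[of "[]" t' k s' j r A] unfolding r by simp
  thus ?thesis by (auto simp: trail_eq_def)
next
  case False
  thus ?thesis using p trail_eq_refl by (simp add: swap_def)
qed

lemma swap_set_last: "p \<in> trails A \<Longrightarrow> swap s t k (set_last p n) = set_last (swap s t k p) n"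
  by (cases p; cases "tl p") (auto simp: swap_def set_last_def trails_iff)

lemma swap_last: "p \<in> trails A \<Longrightarrow> last (swap s t k p) = last p"
  by (auto simp: swap_def trails_iff)

text \<open>Closure in one direction suffices because the exchange is an involution on classes;
  \<open>swap_invariantD\<close> derives the equivalence from \<open>swap_swap\<close>.\<close>

definition swap_invariant :: "'a ra_alg \<Rightarrow> ('a trail set \<times> 'a trail set) set set" where
  "swap_invariant A = {R. R \<subseteq> UB A \<times> UB A \<and> (\<forall>s t k. adjacent A s t k \<longrightarrow>
     (\<forall>p\<in>trails A. \<forall>q\<in>trails A. (trail_cls A p, trail_cls A q) \<in> R \<longrightarrow>
        (trail_cls A (swap s t k p), trail_cls A (swap s t k q)) \<in> R))}"

lemma swap_invariantD:
  assumes "R \<in> swap_invariant A" "adjacent A s t k" "p \<in> trails A" "q \<in> trails A"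
  shows "(trail_cls A (swap s t k p), trail_cls A (swap s t k q)) \<in> R \<longleftrightarrow> (trail_cls A p, trail_cls A q) \<in> R"
proof
  assume "(trail_cls A (swap s t k p), trail_cls A (swap s t k q)) \<in> R"
  hence "(trail_cls A (swap s t k (swap s t k p)), trail_cls A (swap s t k (swap s t k q))) \<in> R"
    using assms swap_trails unfolding swap_invariant_def by blast
  thus "(trail_cls A p, trail_cls A q) \<in> R"
    using trail_cls_eqI[OF swap_swap] assms by metis
qed (use assms in \<open>unfold swap_invariant_def, blast\<close>)

text \<open>Invariance under permutations survives all the operations. The identity relies on
  \<open>swap_eq\<close>, by which the exchange is well defined on classes, and the complement on
  the backward direction of \<open>swap_invariantD\<close>.\<close>

lemma swap_invariant_subalgebra: "set_ra_sub (UB A) (swap_invariant A)"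
  unfolding set_ra_sub_def
proof (intro conjI ballI)
  show "swap_invariant A \<subseteq> Pow (UB A \<times> UB A)" by (auto simp: swap_invariant_def)
  show "Id_on (UB A) \<in> swap_invariant A"
    unfolding swap_invariant_def
  proof (clarify, intro conjI allI impI ballI)
    fix s t k p q assume h: "adjacent A s t k" "p \<in> trails A" "q \<in> trails A"
      "(trail_cls A p, trail_cls A q) \<in> Id_on (UB A)"
    hence "trail_cls A p = trail_cls A q" by blast
    hence "trail_cls A (swap s t k p) = trail_cls A (swap s t k q)"
      using trail_cls_eqI[OF swap_eq[OF h(1) trail_cls_eqD]] h(3) by blast
    moreover have "trail_cls A (swap s t k p) \<in> UB A"
      using swap_trails[OF h(1,2)] by (auto simp: UB_def)
    ultimately show "(trail_cls A (swap s t k p), trail_cls A (swap s t k q)) \<in> Id_on (UB A)"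
      by auto
  qed blast
next
  fix X Y assume X: "X \<in> swap_invariant A" and Y: "Y \<in> swap_invariant A"
  show "X \<union> Y \<in> swap_invariant A" using X Y unfolding swap_invariant_def by blast
  show "X O Y \<in> swap_invariant A"
    unfolding swap_invariant_def
  proof (clarify, intro conjI allI impI ballI)
    show "X O Y \<subseteq> UB A \<times> UB A" using X Y unfolding swap_invariant_def by blast
    fix s t k p q assume h: "adjacent A s t k" "p \<in> trails A" "q \<in> trails A"
      "(trail_cls A p, trail_cls A q) \<in> X O Y"
    then obtain z where z: "(trail_cls A p, z) \<in> X" "(z, trail_cls A q) \<in> Y" by blast
    then obtain r where r: "r \<in> trails A" "z = trail_cls A r"
      using X unfolding swap_invariant_def UB_def by blast
    show "(trail_cls A (swap s t k p), trail_cls A (swap s t k q)) \<in> X O Y"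
      using swap_invariantD[OF X h(1)] swap_invariantD[OF Y h(1)] h z r by blast
  qed
next
  fix X assume X: "X \<in> swap_invariant A"
  show "UB A \<times> UB A - X \<in> swap_invariant A"
    unfolding swap_invariant_def
  proof (clarify, intro conjI allI impI ballI)
    fix s t k p q assume h: "adjacent A s t k" "p \<in> trails A" "q \<in> trails A"
      "(trail_cls A p, trail_cls A q) \<in> UB A \<times> UB A - X"
    thus "(trail_cls A (swap s t k p), trail_cls A (swap s t k q)) \<in> UB A \<times> UB A - X"
      using swap_invariantD[OF X h(1-3)] swap_trails[OF h(1)] by (auto simp: UB_def)
  qed blast
  show "X\<inverse> \<in> swap_invariant A" using X unfolding swap_invariant_def by blast
qed

lemma corner_swap:
  "p \<in> trails A \<Longrightarrow> trail_cls A (swap s t k (set_last p n)) = corner A (swap s t k p) n"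
  by (simp add: corner_def swap_set_last)

text \<open>The atom of a pair is read off from the last triangle, which prefixing leaves
  alone.\<close>

lemma edges_invariant: "edges A a \<in> swap_invariant A"
  unfolding swap_invariant_def
proof (clarify, intro conjI allI impI ballI)
  show "edges A a \<subseteq> UB A \<times> UB A" by (rule edges_subset)
  fix s t k p q assume h: "adjacent A s t k" "p \<in> trails A" "q \<in> trails A"
    "(trail_cls A p, trail_cls A q) \<in> edges A a"
  then obtain r where r: "r \<in> trails A" "cmpnt (fst (last r)) 2 = a"
      "trail_cls A p = corner A r 0" "trail_cls A q = corner A r 1"
    by (auto simp: edges_def)
  have "(p, set_last r 0) \<in> trail_eq A" "(q, set_last r 1) \<in> trail_eq A"
    using r set_last_trails[OF r(1)] by (auto simp: corner_def intro!: trail_cls_eqD)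
  hence "trail_cls A (swap s t k p) = corner A (swap s t k r) 0"
        "trail_cls A (swap s t k q) = corner A (swap s t k r) 1"
    using trail_cls_eqI[OF swap_eq[OF h(1)]] corner_swap[OF r(1)] by metis+
  thus "(trail_cls A (swap s t k p), trail_cls A (swap s t k q)) \<in> edges A a"
    using r edges_01[OF swap_trails[OF h(1) r(1)]] swap_last[OF r(1), of s t k] by simp
qed

lemma invariant_corner:
  assumes "R \<in> swap_invariant A" "p \<in> trails A" "adjacent A s t k"
  shows "(corner A (swap s t k p) 0, corner A (swap s t k p) 1) \<in> R \<longleftrightarrow> (corner A p 0, corner A p 1) \<in> R"
  using swap_invariantD[OF assms(1,3) set_last_trails[OF assms(2), of 0] set_last_trails[OF assms(2), of 1]]
    corner_swap[OF assms(2)] by (simp add: corner_def)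

text \<open>The trail \<open>x # p\<close> is an exchange applied to \<open>p\<close>, so steps can
  be stripped from the front until only the last triangle is left. The index 0 is a placeholder that
  \<open>corner\<close> overwrites.\<close>

lemma invariant_end:
  assumes R: "R \<in> swap_invariant A"
  shows "p \<in> trails A \<Longrightarrow> (corner A p 0, corner A p 1) \<in> R \<longleftrightarrow>
    (corner A [(fst (last p), 0)] 0, corner A [(fst (last p), 0)] 1) \<in> R"
proof (induction p)
  case (Cons x p)
  show ?case
  proof (cases p)
    case Nil
    thus ?thesis by (simp add: corner_def set_last_def)
  next
    case (Cons y r)
    obtain x1 k where x: "x = (x1, k)" by (rule prod.exhaust)
    obtain y1 j where y: "y = (y1, j)" by (rule prod.exhaust)
    have p: "p \<in> trails A" and a: "adjacent A x1 y1 k"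
      using Cons.prems Cons x y by (auto simp: trails_iff adjacent_def)
    have "swap x1 y1 k p = x # p" using Cons x y by (simp add: swap_def)
    thus ?thesis using invariant_corner[OF R p a] Cons.IH[OF p] Cons by simp
  qed
qed (simp add: trails_iff)

text \<open>By \<open>invariant_end\<close> only the last triangles \<open>s\<close> and
  \<open>t\<close> count. They share face 2, on which the corners 0 and 1 lie, so one exchange
  across it carries the pair of \<open>s\<close> to that of \<open>t\<close>.\<close>

lemma invariant_transitive:
  assumes R: "R \<in> swap_invariant A" and "(u, v) \<in> edges A a" "(u', v') \<in> edges A a" "(u, v) \<in> R"
  shows "(u', v') \<in> R"
proof -
  obtain p q where p: "p \<in> trails A" "u = corner A p 0" "v = corner A p 1" "cmpnt (fst (last p)) 2 = a"
    and q: "q \<in> trails A" "u' = corner A q 0" "v' = corner A q 1" "cmpnt (fst (last q)) 2 = a"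
    using assms unfolding edges_def by blast
  define s t where "s = fst (last p)" and "t = fst (last q)"
  have st: "s \<in> SB A" "t \<in> SB A" "cmpnt s 2 = cmpnt t 2"
    using p q last_SB by (auto simp: s_def t_def)
  have s: "(corner A [(s, 0)] 0, corner A [(s, 0)] 1) \<in> R"
    using invariant_end[OF R p(1)] assms(4) p by (simp add: s_def)
  have "(corner A [(t, 0)] 0, corner A [(t, 0)] 1) \<in> R"
  proof (cases "s = t")
    case False
    hence a: "adjacent A s t 2" using st by (simp add: adjacent_def)
    have "(corner A (swap s t 2 [(s, 0)]) 0, corner A (swap s t 2 [(s, 0)]) 1) \<in> R"
      using invariant_corner[OF R single_trail[OF st(1)] a] s by blast
    moreover have "corner A (swap s t 2 [(s, 0)]) n = corner A [(t, 0)] n" if "n < 2" for n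
    proof -
      have "(set_last (swap s t 2 [(s, 0)]) n, set_last [(t, 0)] n) \<in> trail_gen A"
        using that st False trail_gen_cross[of "[]" t 2 s n A]
        by (simp add: swap_def set_last_def trails_iff)
      thus ?thesis using trail_cls_gen by (simp add: corner_def)
    qed
    ultimately show ?thesis by simp
  qed (use s in simp)
  thus ?thesis using invariant_end[OF R q(1)] q by (simp add: t_def)
qed

section \<open>The representation\<close>

context atomic_wa
begin

section \<open>Labels of pairs of classes, pulled back from the free model\<close>

definition model_pt :: "'a trail set \<Rightarrow> 'a pt" where
  "model_pt u = pt_of (SOME p. p \<in> u)"

lemma model_pt_cls:
  assumes "p \<in> trails A" shows "model_pt (trail_cls A p) = pt_of p"
proof -
  have "p \<in> trail_cls A p" using trail_eq_refl[OF assms] by (simp add: trail_cls_def)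
  hence "(SOME q. q \<in> trail_cls A p) \<in> trail_cls A p" by (rule someI)
  thus ?thesis using pt_of_eq unfolding model_pt_def trail_cls_def by force
qed

lemma model_pt_corner:
  assumes "p \<in> trails A" "n < 3" shows "model_pt (corner A p n) = pos (stack p) n"
proof -
  obtain r x where r: "p = r @ [x]" using assms by (cases p rule: rev_cases) (auto simp: trails_iff)
  have "pos (stack (set_last p n)) = pos (stack p)"
    using pos_change_hd[of "(fst x, n)" x] by (simp add: r stack_snoc push_def)
  thus ?thesis using model_pt_cls[OF set_last_trails[OF assms]] by (simp add: corner_def pt_of_def)
qed

lemma edges_lab:
  assumes "(u, v) \<in> edges A a" shows "lab (model_pt u) (model_pt v) a"
proof -
  obtain p where p: "p \<in> trails A" "u = corner A p 0" "v = corner A p 1" "cmpnt (fst (last p)) 2 = a"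
    using assms unfolding edges_def by blast
  thus ?thesis using pos_stack_realises[OF p(1)] model_pt_corner[OF p(1)]
    by (simp add: realises_def)
qed

lemma edges_unique: "(u, v) \<in> edges A a \<Longrightarrow> (u, v) \<in> edges A b \<Longrightarrow> a = b"
  using edges_lab lab_unique by blast

lemma edges_triangle:
  "(u, v) \<in> edges A c \<Longrightarrow> (u, w) \<in> edges A a \<Longrightarrow> (w, v) \<in> edges A b \<Longrightarrow> C a b c"
  using edges_lab lab_triangle by blast

lemma edges_atom: "(u, v) \<in> edges A a \<Longrightarrow> a \<in> At"
  using edges_lab lab_atom by blast

lemma SB_triple: "(b, c, a) \<in> SB A \<longleftrightarrow> C a b c"
  by (simp add: SB_iff cmpnt_def)

lemma cmpnt_simps [simp]: "cmpnt (b, c, a) 0 = b" "cmpnt (b, c, a) 1 = c" "cmpnt (b, c, a) (Suc 0) = c" "cmpnt (b, c, a) 2 = a"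
  by (auto simp: cmpnt_def)

lemma SE_I:
  assumes "t \<in> SB A" "l < 3" "k < 3" "l \<noteq> k" "cmpnt t (3 - l - k) \<in> I" shows "t \<in> SE A l k"
  using assms I_le_one by (auto simp: SE_def)

text \<open>Crossing face 1 to the triangle \<open>(rn c, c, c)\<close>, whose corners 1 and 2 are
  identified, turns the edge 02 into an edge 01.\<close>

lemma edges_02:
  assumes p: "p \<in> trails A" shows "(corner A p 0, corner A p 2) \<in> edges A (cmpnt (fst (last p)) 1)"
proof -
  define c where "c = cmpnt (fst (last p)) 1"
  have c: "c \<in> At" using last_SB[OF p] SB_iff C_atoms c_def by blast
  have s: "(rn c, c, c) \<in> SB A" using rn[OF c] by (simp add: SB_triple)
  obtain q where q: "q \<in> trails A" "fst (last q) = (rn c, c, c)"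
      "\<And>n. n < 3 \<Longrightarrow> n \<noteq> 1 \<Longrightarrow> corner A q n = corner A p n"
    using trail_extend[OF p s, of 1] by (auto simp: c_def)
  have "corner A q 1 = corner A q 2"
    using rn(1)[OF c] s q by (intro corner_identified SE_I) auto
  thus ?thesis using edges_01[OF q(1)] q(2) q(3)[of 0] q(3)[of 2] by (simp add: c_def)
qed

text \<open>In \<open>(b, b, dm b)\<close>, reached across face 0, the corners 0 and 1 are
  identified, which reduces the edge 12 to \<open>edges_02\<close>.\<close>

lemma edges_12:
  assumes p: "p \<in> trails A" shows "(corner A p 1, corner A p 2) \<in> edges A (cmpnt (fst (last p)) 0)"
proof -
  define b where "b = cmpnt (fst (last p)) 0"
  have b: "b \<in> At" using last_SB[OF p] SB_iff C_atoms b_def by blast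
  have s: "(b, b, dm b) \<in> SB A" using dm[OF b] by (simp add: SB_triple)
  obtain q where q: "q \<in> trails A" "fst (last q) = (b, b, dm b)"
      "\<And>n. n < 3 \<Longrightarrow> n \<noteq> 0 \<Longrightarrow> corner A q n = corner A p n"
    using trail_extend[OF p s, of 0] by (auto simp: b_def)
  have "corner A q 0 = corner A q 1"
    using dm(1)[OF b] s q by (intro corner_identified SE_I) (auto simp: numeral_2_eq_2[symmetric])
  thus ?thesis using edges_02[OF q(1)] q(2) q(3)[of 1] q(3)[of 2] by (simp add: b_def)
qed

text \<open>In \<open>(a\<^sup>c, dm a, a)\<close>, reached across face 2, the corners 0 and 2 are
  identified, so its edge 12 is the given edge reversed.\<close>

lemma edges_cnv:
  assumes "(u, v) \<in> edges A a" shows "(v, u) \<in> edges A (a\<^sup>c)"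
proof -
  obtain p where p: "p \<in> trails A" "u = corner A p 0" "v = corner A p 1" "cmpnt (fst (last p)) 2 = a"
    using assms unfolding edges_def by blast
  have a: "a \<in> At" using assms edges_atom by blast
  have s: "(a\<^sup>c, dm a, a) \<in> SB A" using C_dm_cnv[OF a] by (simp add: SB_triple)
  obtain q where q: "q \<in> trails A" "fst (last q) = (a\<^sup>c, dm a, a)"
      "\<And>n. n < 3 \<Longrightarrow> n \<noteq> 2 \<Longrightarrow> corner A q n = corner A p n"
    using trail_extend[OF p(1) s, of 2] p(4) by auto
  have "corner A q 0 = corner A q 2"
    using dm(1)[OF a] s q by (intro corner_identified SE_I) auto
  thus ?thesis using edges_12[OF q(1)] q(2) q(3)[of 0] q(3)[of 1] p by simp
qed

text \<open>The required triangle \<open>(b, c, a)\<close> has \<open>c\<close> on its edge 02,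
  while the pair sits on an edge 01. The degenerate triangle \<open>(rn c, c, c)\<close> has
  \<open>c\<close> on both and mediates; corner 1 of the final triangle is \<open>w\<close>.\<close>

lemma edges_cmp:
  assumes "(u, v) \<in> edges A c" "C a b c"
  obtains w where "(u, w) \<in> edges A a" "(w, v) \<in> edges A b"
proof -
  obtain p where p: "p \<in> trails A" "u = corner A p 0" "v = corner A p 1" "cmpnt (fst (last p)) 2 = c"
    using assms unfolding edges_def by blast
  have c: "c \<in> At" using assms edges_atom by blast
  have s: "(rn c, c, c) \<in> SB A" using rn[OF c] by (simp add: SB_triple)
  obtain q where q: "q \<in> trails A" "fst (last q) = (rn c, c, c)"
      "\<And>n. n < 3 \<Longrightarrow> n \<noteq> 2 \<Longrightarrow> corner A q n = corner A p n"
    using trail_extend[OF p(1) s, of 2] p(4) by auto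
  have e: "corner A q 1 = corner A q 2"
    using rn(1)[OF c] s q by (intro corner_identified SE_I) auto
  have s': "(b, c, a) \<in> SB A" using assms by (simp add: SB_triple)
  obtain r where r: "r \<in> trails A" "fst (last r) = (b, c, a)"
      "\<And>n. n < 3 \<Longrightarrow> n \<noteq> 1 \<Longrightarrow> corner A r n = corner A q n"
    using trail_extend[OF q(1) s', of 1] q(2) by auto
  have "u = corner A r 0" "v = corner A r 2" using p q(3) r(3) e by auto
  thus ?thesis using that edges_01[OF r(1)] edges_12[OF r(1)] r(2) by auto
qed

lemma edges_I_iff:
  assumes "(u, v) \<in> edges A a" shows "a \<in> I \<longleftrightarrow> u = v"
proof
  assume a: "a \<in> I"
  obtain p where p: "p \<in> trails A" "u = corner A p 0" "v = corner A p 1" "cmpnt (fst (last p)) 2 = a"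
    using assms unfolding edges_def by blast
  have "corner A p 0 = corner A p 1"
    using p a last_SB[OF p(1)] by (intro corner_identified SE_I) (auto simp: numeral_2_eq_2[symmetric])
  thus "u = v" using p by simp
next
  assume "u = v"
  thus "a \<in> I" using edges_lab[OF assms] lab_same by blast
qed

lemma edges_nonempty:
  assumes "a \<in> At" shows "edges A a \<noteq> {}"
proof -
  have "(rn a, a, a) \<in> SB A" using rn assms by (simp add: SB_triple)
  from edges_01[OF single_trail[OF this]] show ?thesis by auto
qed

section \<open>The representation map and its image\<close>

definition rep :: "'a \<Rightarrow> ('a trail set \<times> 'a trail set) set" where
  "rep x = (\<Union>a\<in>{a \<in> At. a \<sqsubseteq> x}. edges A a)"

lemma SS_edges: "SS A = (\<Union>a\<in>At. edges A a)"
proof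
  show "SS A \<subseteq> (\<Union>a\<in>At. edges A a)"
  proof (clarsimp simp: SS_def VB_def RB_def)
    fix p t assume p: "p \<in> trails A" "ends_at p t"
    have "(corner A p 0, corner A p 1) \<in> edges A (cmpnt (fst (last p)) 2)" using edges_01 p by blast
    thus "\<exists>a\<in>At. (trail_cls A (set_last p 0), trail_cls A (set_last p (Suc 0))) \<in> edges A a"
      using edges_atom by (auto simp: corner_def)
  qed
  show "(\<Union>a\<in>At. edges A a) \<subseteq> SS A"
  proof clarify
    fix u v a assume "(u, v) \<in> edges A a"
    then obtain p where p: "p \<in> trails A" "u = corner A p 0" "v = corner A p 1"
      unfolding edges_def by blast
    have "(corner A p 0, corner A p 1, corner A p 2) \<in> RB A (fst (last p))"
      using p(1) trails_nonempty[OF p(1)] unfolding RB_def ends_at_def corner_def by blast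
    thus "(u, v) \<in> SS A"
      using p corner_UB[OF p(1)] last_SB[OF p(1)] unfolding SS_def VB_def by auto
  qed
qed

text \<open>A pair carries a single atom by \<open>edges_unique\<close>, so this atom decides
  membership. With \<open>SS_eqI\<close>, the identities for \<open>rep\<close> then become
  statements about atoms.\<close>

lemma edges_rep:
  assumes "(u, v) \<in> edges A a" shows "(u, v) \<in> rep x \<longleftrightarrow> a \<sqsubseteq> x"
proof
  assume "(u, v) \<in> rep x"
  then obtain b where "b \<sqsubseteq> x" "(u, v) \<in> edges A b" unfolding rep_def by blast
  thus "a \<sqsubseteq> x" using edges_unique[OF assms] by blast
qed (use assms edges_atom[OF assms] in \<open>unfold rep_def, blast\<close>)

lemma rep_subset: "rep x \<subseteq> SS A"
  unfolding rep_def SS_edges by blast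

lemma SS_eqI:
  assumes "X \<subseteq> SS A" "Y \<subseteq> SS A"
    "\<And>u v a. a \<in> At \<Longrightarrow> (u, v) \<in> edges A a \<Longrightarrow> (u, v) \<in> X \<longleftrightarrow> (u, v) \<in> Y"
  shows "X = Y"
proof (rule set_eqI, rule iffI)
  fix z assume z: "z \<in> X"
  then obtain a where "a \<in> At" "z \<in> edges A a" using assms(1) SS_edges by blast
  thus "z \<in> Y" using assms(3)[of a "fst z" "snd z"] z by simp
next
  fix z assume z: "z \<in> Y"
  then obtain a where "a \<in> At" "z \<in> edges A a" using assms(2) SS_edges by blast
  thus "z \<in> X" using assms(3)[of a "fst z" "snd z"] z by simp
qed

lemma SS_I: "(u, v) \<in> edges A a \<Longrightarrow> (u, v) \<in> SS A"
  using edges_atom SS_edges by blast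

lemma SS_subset: "SS A \<subseteq> UB A \<times> UB A"
  by (auto simp: SS_def)

lemma rep_plus:
  assumes "x \<in> K" "y \<in> K" shows "rep (x \<oplus> y) = (rep x \<union> rep y) \<inter> SS A"
  using assms by (intro SS_eqI) (auto simp: rep_subset edges_rep atom_le_plus SS_I)

lemma rep_cmpl:
  assumes "x \<in> K" shows "rep (\<sim> x) = (UB A \<times> UB A - rep x) \<inter> SS A"
proof (rule SS_eqI)
  fix u v a assume a: "a \<in> At" "(u, v) \<in> edges A a"
  thus "(u, v) \<in> rep (\<sim> x) \<longleftrightarrow> (u, v) \<in> (UB A \<times> UB A - rep x) \<inter> SS A"
    using assms edges_rep[OF a(2)] SS_I[OF a(2)] SS_subset by (auto simp: atom_le_compl)
qed (auto simp: rep_subset)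

lemma rep_cnv:
  assumes "x \<in> K" shows "rep (x\<^sup>c) = (rep x)\<inverse> \<inter> SS A"
proof (rule SS_eqI)
  fix u v a assume a: "a \<in> At" "(u, v) \<in> edges A a"
  thus "(u, v) \<in> rep (x\<^sup>c) \<longleftrightarrow> (u, v) \<in> (rep x)\<inverse> \<inter> SS A"
    using assms edges_rep[OF a(2)] edges_rep[OF edges_cnv[OF a(2)]] SS_I[OF a(2)]
      cnv_le_iff[of a x] by auto
qed (auto simp: rep_subset)

lemma rep_ident: "rep one = Id_on (UB A) \<inter> SS A"
proof (rule SS_eqI)
  fix u v a assume a: "a \<in> At" "(u, v) \<in> edges A a"
  have "a \<in> I \<longleftrightarrow> a \<sqsubseteq> one" using a I_le_one I_intro by blast
  thus "(u, v) \<in> rep one \<longleftrightarrow> (u, v) \<in> Id_on (UB A) \<inter> SS A"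
    using edges_rep[OF a(2)] SS_I[OF a(2)] SS_subset edges_I_iff[OF a(2)] by (auto simp: Id_on_def)
qed (auto simp: rep_subset)

text \<open>From left to right, \<open>cmp_atoms\<close> finds a consistent triangle in the algebra
  and \<open>edges_cmp\<close> realises it. The converse needs
  \<open>edges_triangle\<close>.\<close>

lemma rep_cmp:
  assumes "x \<in> K" "y \<in> K" shows "rep (x \<odot> y) = (rep x O rep y) \<inter> SS A"
proof (rule SS_eqI)
  fix u v c assume c: "c \<in> At" "(u, v) \<in> edges A c"
  have "c \<sqsubseteq> x \<odot> y \<longleftrightarrow> (u, v) \<in> rep x O rep y"
  proof
    assume "c \<sqsubseteq> x \<odot> y"
    then obtain a b where ab: "a \<sqsubseteq> x" "b \<sqsubseteq> y" "C a b c" using cmp_atoms assms c by blast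
    obtain w where "(u, w) \<in> edges A a" "(w, v) \<in> edges A b" using edges_cmp[OF c(2) ab(3)] .
    thus "(u, v) \<in> rep x O rep y" using edges_rep ab by blast
  next
    assume "(u, v) \<in> rep x O rep y"
    then obtain w a b where w: "(u, w) \<in> edges A a" "a \<sqsubseteq> x" "(w, v) \<in> edges A b" "b \<sqsubseteq> y"
      unfolding rep_def by blast
    have C: "C a b c" using edges_triangle c w by blast
    have "a \<odot> b \<sqsubseteq> x \<odot> y" using C_atoms[OF C] assms w by (intro cmp_mono) auto
    thus "c \<sqsubseteq> x \<odot> y" using C C_atoms[OF C] assms le_trans[of c "a \<odot> b"] by (auto simp: C_def)
  qed
  thus "(u, v) \<in> rep (x \<odot> y) \<longleftrightarrow> (u, v) \<in> (rep x O rep y) \<inter> SS A"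
    using edges_rep[OF c(2)] SS_I[OF c(2)] by simp
qed (auto simp: rep_subset)

lemma rep_inj: "inj_on rep K"
proof (rule inj_onI)
  have le: "x \<sqsubseteq> y" if "x \<in> K" "y \<in> K" "rep x = rep y" for x y
  proof (rule le_if_atoms_le)
    fix a assume a: "a \<in> At" "a \<sqsubseteq> x"
    then obtain u v where "(u, v) \<in> edges A a" using edges_nonempty by fast
    thus "a \<sqsubseteq> y" using edges_rep a that by blast
  qed (use that in auto)
  fix x y assume "x \<in> K" "y \<in> K" "rep x = rep y"
  thus "x = y" using le[of x y] le[of y x] le_antisym by simp
qed

lemma rep_invariant: "rep x \<in> swap_invariant A"
  unfolding swap_invariant_def
proof (clarify, intro conjI allI impI ballI)
  show "rep x \<subseteq> UB A \<times> UB A" using rep_subset SS_subset by blast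
  fix s t k p q assume h: "adjacent A s t k" "p \<in> trails A" "q \<in> trails A"
    "(trail_cls A p, trail_cls A q) \<in> rep x"
  then obtain a where a: "a \<in> At" "a \<sqsubseteq> x" "(trail_cls A p, trail_cls A q) \<in> edges A a"
    unfolding rep_def by blast
  hence "(trail_cls A (swap s t k p), trail_cls A (swap s t k q)) \<in> edges A a"
    using swap_invariantD[OF edges_invariant h(1-3)] by blast
  thus "(trail_cls A (swap s t k p), trail_cls A (swap s t k q)) \<in> rep x"
    using edges_rep a by blast
qed

text \<open>By \<open>invariant_transitive\<close>, \<open>R\<close> contains all of
  \<open>edges A a\<close> or none of it, so its trace is determined by the set \<open>X\<close> of
  atoms that it meets; completeness supplies the supremum of \<open>X\<close>.\<close>

lemma invariant_rep:
  assumes "ra_complete A" "R \<in> swap_invariant A" shows "\<exists>x\<in>K. R \<inter> SS A = rep x"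
proof -
  define X where "X = {a \<in> At. edges A a \<inter> R \<noteq> {}}"
  have XK: "X \<subseteq> K" by (auto simp: X_def)
  obtain s where s: "s \<in> K" "\<And>x. x \<in> X \<Longrightarrow> x \<sqsubseteq> s"
      "\<And>u. u \<in> K \<Longrightarrow> (\<And>x. x \<in> X \<Longrightarrow> x \<sqsubseteq> u) \<Longrightarrow> s \<sqsubseteq> u"
    using assms(1) XK unfolding ra_complete_def by meson
  \<comment> \<open>The supremum has no atoms outside \<open>X\<close>: for such an atom
    \<open>a\<close>, already \<open>\<sim> a\<close> would be an upper bound of
    \<open>X\<close>.\<close>
  have at: "a \<in> X \<longleftrightarrow> a \<sqsubseteq> s" if a: "a \<in> At" for a
  proof
    assume l: "a \<sqsubseteq> s"
    show "a \<in> X"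
    proof (rule ccontr)
      assume n: "a \<notin> X"
      have "x \<sqsubseteq> \<sim> a" if "x \<in> X" for x
      proof -
        have "x \<in> At" using that X_def by blast
        thus ?thesis using atom_le_compl[of x a] atom_le_atom[of a x] a n that by auto
      qed
      hence "s \<sqsubseteq> \<sim> a" using s(3)[of "\<sim> a"] a by simp
      hence "a \<sqsubseteq> \<sim> a" using le_trans[of a s "\<sim> a"] l a s(1) by simp
      thus False using atom_le_compl[of a a] a by simp
    qed
  qed (use s in simp)
  have "R \<inter> SS A = rep s"
  proof (rule SS_eqI)
    fix u v a assume a: "a \<in> At" "(u, v) \<in> edges A a"
    have "(u, v) \<in> R \<longleftrightarrow> a \<in> X"
      using invariant_transitive[OF assms(2)] a unfolding X_def by fast
    thus "(u, v) \<in> R \<inter> SS A \<longleftrightarrow> (u, v) \<in> rep s"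
      using at[OF a(1)] edges_rep[OF a(2)] SS_I[OF a(2)] by simp
  qed (auto simp: rep_subset)
  thus ?thesis using s(1) by blast
qed

lemma rep_image:
  assumes "ra_complete A" shows "rep ` K = (\<lambda>X. X \<inter> SS A) ` swap_invariant A"
proof
  show "rep ` K \<subseteq> (\<lambda>X. X \<inter> SS A) ` swap_invariant A"
  proof clarify
    fix x assume "x \<in> K"
    have "rep x = rep x \<inter> SS A" using rep_subset by blast
    thus "rep x \<in> (\<lambda>X. X \<inter> SS A) ` swap_invariant A" using rep_invariant by blast
  qed
  show "(\<lambda>X. X \<inter> SS A) ` swap_invariant A \<subseteq> rep ` K" using invariant_rep[OF assms] by blast
qed

end

theorem theorem7:
  fixes A :: "'a ra_alg"
  assumes "WA A" and "ra_complete A" and "ra_atomic A"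
  shows "\<exists>R. set_ra_sub (UB A) R \<and> ra_iso A (relativize (UB A) R (SS A))"
proof -
  interpret atomic_wa A using assms by unfold_locales
  have "ra_iso A (relativize (UB A) (swap_invariant A) (SS A))"
    unfolding ra_iso_def relativize_def ra_alg.select_convs bij_betw_def
    using rep_inj rep_image[OF assms(2)] rep_plus rep_cmp rep_cmpl rep_cnv rep_ident
    by (intro exI[of _ rep] conjI ballI) auto
  thus ?thesis using swap_invariant_subalgebra by blast
qed

end
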